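(* Let $X$ be a nondiscrete Tychonoff $k_\omega$ space, let $\kappa$ be the compact weight of $X$, and let $A(X)$ be the free abelian topological group over $X$. Then $$\chi(A(X))=\max\bigl(\mathfrak d,\ \mathrm{cof}([\kappa]^{\aleph_0})\bigr).$$
   Context: The free abelian topological group $A(X)$ over a Tychonoff space $X$ is the abelian topological group containing $X$ with the universal property that each continuous function from $X$ into any abelian topological group $H$ extends uniquely to a continuous homomorphism $A(X)\to H$. The character $\chi(G)$ of a topological group is the minimal cardinality of a local base at the identity. The compact weight of a space $X$ is the supremum of the weights (minimal cardinalities of bases) of the compact subsets of $X$. A space $X$ is $k_\omega$ if there are compact sets $K_1,K_2,\dots\subseteq X$ such that each compact $K\subseteq X$ is contained in some $K_n$, and each $U\subseteq X$ such that $U\cap K_n$ is open in $K_n$ for all $n$ is open in $X$. For a partially ordered set $P$, $\mathrm{cof}(P)$ is the minimal cardinality of a cofinal subset of $P$. $\mathfrak d$ is the cofinality of $\mathbb N^{\mathbb N}$ ordered by $f\le g$ iff $f(n)\le g(n)$ for all $n$. $[\kappa]^{\aleph_0}$ is the family of countably infinite subsets of $\kappa$, ordered by inclusion. *)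

theory Defs
  imports "HOL-Analysis.Analysis" "HOL-Algebra.Free_Abelian_Groups"
begin

section \<open>Abelian topological groups and the universal property\<close>

text \<open>No separation axiom is imposed on topological groups.\<close>

definition abelian_topological_group :: "'g monoid \<Rightarrow> 'g topology \<Rightarrow> bool" where
  "abelian_topological_group G T \<longleftrightarrow>
     comm_group G \<and> topspace T = carrier G \<and>
     continuous_map (prod_topology T T) T (\<lambda>(x, y). x \<otimes>\<^bsub>G\<^esub> y) \<and>
     continuous_map T T (\<lambda>x. inv\<^bsub>G\<^esub> x)"

text \<open>Every continuous map from \<open>X\<close> into \<open>H\<close> extends uniquely along \<open>i\<close> to a continuous
  homomorphism from \<open>A\<close> into \<open>H\<close>. Restricting to \<^const>\<open>extensional\<close> functions makes uniqueness
  refer to the values on \<open>carrier A\<close> only.\<close>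

definition extends_uniquely ::
  "'a topology \<Rightarrow> 'g monoid \<Rightarrow> 'g topology \<Rightarrow> ('a \<Rightarrow> 'g) \<Rightarrow> 'h monoid \<Rightarrow> 'h topology \<Rightarrow> bool" where
  "extends_uniquely X A T i H TH \<longleftrightarrow>
     (\<forall>f. continuous_map X TH f \<longrightarrow>
        (\<exists>!h. h \<in> extensional (carrier A) \<and> h \<in> hom A H \<and> continuous_map T TH h \<and>
              (\<forall>x\<in>topspace X. h (i x) = f x)))"

text \<open>\<open>(A, T)\<close> is the free abelian topological group over \<open>X\<close>, which it contains via the topological
  embedding \<open>i\<close>. HOL cannot quantify over all types inside a definition, so the target groups \<open>H\<close>
  range over a fixed type, \<open>'g \<times> nat\<close>. This type is big enough: by
  \<open>free_abelian_topological_group_extends\<close> below, the property then holds for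
  abelian topological groups \<open>H\<close> of every type.\<close>

definition free_abelian_topological_group ::
  "'a topology \<Rightarrow> 'g monoid \<Rightarrow> 'g topology \<Rightarrow> ('a \<Rightarrow> 'g) \<Rightarrow> bool" where
  "free_abelian_topological_group X A T i \<longleftrightarrow>
     abelian_topological_group A T \<and> embedding_map X T i \<and>
     (\<forall>(H :: ('g \<times> nat) monoid) TH.
        abelian_topological_group H TH \<longrightarrow> extends_uniquely X A T i H TH)"


section \<open>Cardinal invariants\<close>

text \<open>Cardinals are cardinal orders; they are compared by \<open>\<le>o\<close> and \<open>=o\<close>, also across types.\<close>

text \<open>The minimal cardinality of a set satisfying \<open>P\<close>.\<close>

definition min_card :: "('a set \<Rightarrow> bool) \<Rightarrow> 'a rel" where
  "min_card P = |SOME B. P B \<and> (\<forall>B'. P B' \<longrightarrow> |B| \<le>o |B'| )|"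

text \<open>The supremum of a set of cardinals. It fits on the type \<open>'a\<close> carrying the given cardinals,
  and it is least among upper bounds on all types: see lemma \<open>card_Sup\<close> below.\<close>

definition card_Sup :: "'a rel set \<Rightarrow> 'a rel" where
  "card_Sup R = (SOME k. Card_order k \<and> (\<forall>r\<in>R. r \<le>o k) \<and>
     (\<forall>k' :: 'a rel. Card_order k' \<and> (\<forall>r\<in>R. r \<le>o k') \<longrightarrow> k \<le>o k'))"

definition local_base :: "'a topology \<Rightarrow> 'a \<Rightarrow> 'a set set \<Rightarrow> bool" where
  "local_base X x \<B> \<longleftrightarrow>
     (\<forall>V\<in>\<B>. openin X V \<and> x \<in> V) \<and> (\<forall>U. openin X U \<and> x \<in> U \<longrightarrow> (\<exists>V\<in>\<B>. V \<subseteq> U))"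

definition base_of :: "'a topology \<Rightarrow> 'a set set \<Rightarrow> bool" where
  "base_of X \<B> \<longleftrightarrow>
     (\<forall>V\<in>\<B>. openin X V) \<and> (\<forall>U x. openin X U \<and> x \<in> U \<longrightarrow> (\<exists>V\<in>\<B>. x \<in> V \<and> V \<subseteq> U))"

definition group_character :: "'g monoid \<Rightarrow> 'g topology \<Rightarrow> 'g set rel" where
  "group_character G T = min_card (local_base T \<one>\<^bsub>G\<^esub>)"

definition weight :: "'a topology \<Rightarrow> 'a set rel" where
  "weight X = min_card (base_of X)"

definition compact_weight :: "'a topology \<Rightarrow> 'a set rel" where
  "compact_weight X = card_Sup {weight (subtopology X K) | K. compactin X K}"

definition cof :: "'a::order set \<Rightarrow> 'a rel" where
  "cof P = min_card (\<lambda>C. C \<subseteq> P \<and> (\<forall>p\<in>P. \<exists>c\<in>C. p \<le> c))"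

text \<open>The order on \<^typ>\<open>nat \<Rightarrow> nat\<close> is the pointwise one.\<close>

definition dominating_number :: "(nat \<Rightarrow> nat) rel" where
  "dominating_number = cof UNIV"

definition countably_infinite_subsets :: "'a set \<Rightarrow> 'a set set" where
  "countably_infinite_subsets S = {C. C \<subseteq> S \<and> countable C \<and> infinite C}"


section \<open>The class of spaces\<close>

definition tychonoff_space :: "'a topology \<Rightarrow> bool" where
  "tychonoff_space X \<longleftrightarrow> completely_regular_space X \<and> Hausdorff_space X"

definition k_omega_space :: "'a topology \<Rightarrow> bool" where
  "k_omega_space X \<longleftrightarrow>
     (\<exists>K :: nat \<Rightarrow> 'a set.
        (\<forall>n. compactin X (K n)) \<and>
        (\<forall>C. compactin X C \<longrightarrow> (\<exists>n. C \<subseteq> K n)) \<and>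
        (\<forall>U. U \<subseteq> topspace X \<and> (\<forall>n. openin (subtopology X (K n)) (U \<inter> K n)) \<longrightarrow> openin X U))"


section \<open>The choices above are well defined\<close>

lemma min_card:
  assumes "P B0"
  obtains B where "P B" "min_card P = |B|" "\<And>B'. P B' \<Longrightarrow> min_card P \<le>o |B'|"
proof -
  have "\<exists>r\<in>{|B| | B. P B}. \<forall>r'\<in>{|B| | B. P B}. r \<le>o r'"
    by (rule exists_minim_Card_order) (use assms in \<open>auto simp: card_of_Card_order\<close>)
  then have "\<exists>B. P B \<and> (\<forall>B'. P B' \<longrightarrow> |B| \<le>o |B'| )"
    by auto
  from someI_ex[OF this] show ?thesis
    using that unfolding min_card_def by auto
qed

lemma card_Sup:
  fixes R :: "'a rel set"
  assumes "\<And>r. r \<in> R \<Longrightarrow> Card_order r"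
  shows "Card_order (card_Sup R)"
    and "\<And>r. r \<in> R \<Longrightarrow> r \<le>o card_Sup R"
    and "\<And>k :: 'b rel. Card_order k \<Longrightarrow> (\<And>r. r \<in> R \<Longrightarrow> r \<le>o k) \<Longrightarrow> card_Sup R \<le>o k"
proof -
  let ?Q = "{k :: 'a rel. Card_order k \<and> (\<forall>r\<in>R. r \<le>o k)}"
  have "r \<le>o |UNIV :: 'a set|" if "r \<in> R" for r
    using assms[OF that] card_of_Field_ordIso card_of_mono1 ordIso_ordLeq_trans
      ordIso_symmetric subset_UNIV by metis
  then have "|UNIV :: 'a set| \<in> ?Q"
    by (simp add: card_of_card_order_on Field_card_of)
  then have "\<exists>k\<in>?Q. \<forall>k'\<in>?Q. k \<le>o k'"
    using exists_minim_Card_order[of ?Q] by blast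
  then have "\<exists>k :: 'a rel. Card_order k \<and> (\<forall>r\<in>R. r \<le>o k) \<and>
     (\<forall>k' :: 'a rel. Card_order k' \<and> (\<forall>r\<in>R. r \<le>o k') \<longrightarrow> k \<le>o k')"
    by blast
  from someI_ex[OF this]
  have card_Sup: "Card_order (card_Sup R) \<and> (\<forall>r\<in>R. r \<le>o card_Sup R) \<and>
     (\<forall>k' :: 'a rel. Card_order k' \<and> (\<forall>r\<in>R. r \<le>o k') \<longrightarrow> card_Sup R \<le>o k')"
    unfolding card_Sup_def by assumption
  then have *: "Card_order (card_Sup R)" "\<And>r. r \<in> R \<Longrightarrow> r \<le>o card_Sup R"
    "\<And>k' :: 'a rel. Card_order k' \<Longrightarrow> (\<And>r. r \<in> R \<Longrightarrow> r \<le>o k') \<Longrightarrow> card_Sup R \<le>o k'"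
    by (simp_all only: Ball_def) auto
  show "Card_order (card_Sup R)" "\<And>r. r \<in> R \<Longrightarrow> r \<le>o card_Sup R"
    by (fact *)+
  fix k :: "'b rel"
  assume k: "Card_order k" "\<And>r. r \<in> R \<Longrightarrow> r \<le>o k"
  show "card_Sup R \<le>o k"
  proof (rule ccontr)
    assume "\<not> card_Sup R \<le>o k"
    then have "k \<le>o card_Sup R"
      using *(1) k(1) ordLeq_total unfolding card_order_on_def by blast
    then obtain k' :: "'a rel" where k': "k =o k'" "Card_order k'"
      using *(1) k(1)
      by (metis Card_order_ordIso2 internalize_ordLeq ordIso_symmetric)
    have "card_Sup R \<le>o k'"
      using *(3)[OF k'(2)] k(2) k'(1) ordLeq_ordIso_trans by blast
    then show False
      using \<open>\<not> card_Sup R \<le>o k\<close> k'(1) ordIso_symmetric ordLeq_ordIso_trans by blast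
  qed
qed


section \<open>The universal property holds for targets of every type\<close>

lemma abelian_topological_group_transport:
  fixes s :: "'h \<Rightarrow> 'k"
  assumes H: "abelian_topological_group H TH" and inj: "inj_on s (carrier H)"
  obtains H' :: "'k monoid" and TH' t where
    "abelian_topological_group H' TH'"
    "s \<in> hom H H'" "continuous_map TH TH' s"
    "t \<in> hom H' H" "continuous_map TH' TH t"
    "\<And>x. x \<in> carrier H \<Longrightarrow> t (s x) = x"
proof -
  define t where "t = inv_into (carrier H) s"
  define H' where "H' = \<lparr>carrier = s ` carrier H,
    monoid.mult = (\<lambda>x y. s (t x \<otimes>\<^bsub>H\<^esub> t y)), one = s \<one>\<^bsub>H\<^esub>\<rparr>"
  define TH' where "TH' = pullback_topology (s ` carrier H) t TH"
  interpret H: comm_group H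
    using H by (simp add: abelian_topological_group_def)
  have top: "topspace TH = carrier H"
    and cm: "continuous_map (prod_topology TH TH) TH (\<lambda>(x, y). x \<otimes>\<^bsub>H\<^esub> y)"
    and ci: "continuous_map TH TH (\<lambda>x. inv\<^bsub>H\<^esub> x)"
    using H by (auto simp: abelian_topological_group_def)
  have ts: "t (s x) = x" if "x \<in> carrier H" for x
    using inj that by (simp add: t_def)
  have simps: "carrier H' = s ` carrier H" "\<one>\<^bsub>H'\<^esub> = s \<one>\<^bsub>H\<^esub>"
    "\<And>x y. x \<otimes>\<^bsub>H'\<^esub> y = s (t x \<otimes>\<^bsub>H\<^esub> t y)"
    by (simp_all add: H'_def)
  have cg: "comm_group H'"
  proof (rule comm_groupI)
    show "\<And>x. x \<in> carrier H' \<Longrightarrow> \<exists>y\<in>carrier H'. y \<otimes>\<^bsub>H'\<^esub> x = \<one>\<^bsub>H'\<^esub>"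
      by (auto simp: simps ts intro!: bexI[where x = "inv\<^bsub>H\<^esub> _"])
    fix x y assume "x \<in> carrier H'" "y \<in> carrier H'"
    then have "t x \<in> carrier H" "t y \<in> carrier H"
      by (auto simp: simps ts)
    then show "x \<otimes>\<^bsub>H'\<^esub> y = y \<otimes>\<^bsub>H'\<^esub> x"
      by (simp add: simps H.m_comm)
  qed (auto simp: simps ts H.m_assoc)
  have top': "topspace TH' = carrier H'"
    using ts by (auto simp: TH'_def topspace_pullback_topology simps top)
  have ct: "continuous_map TH' TH t"
    using continuous_map_pullback[OF continuous_map_id, of "s ` carrier H" t TH]
    by (simp add: TH'_def)
  have cs: "continuous_map TH TH' s"
    unfolding TH'_def
  proof (rule continuous_map_pullback')
    show "continuous_map TH TH (t \<circ> s)"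
      by (rule continuous_map_eq[OF continuous_map_id]) (auto simp: top ts)
  qed (auto simp: top)
  have "continuous_map (prod_topology TH' TH') TH' (\<lambda>(x, y). x \<otimes>\<^bsub>H'\<^esub> y)"
  proof -
    have "continuous_map (prod_topology TH' TH') (prod_topology TH TH) (\<lambda>p. (t (fst p), t (snd p)))"
      using continuous_map_compose[OF continuous_map_fst ct, unfolded o_def]
        continuous_map_compose[OF continuous_map_snd ct, unfolded o_def]
      by (rule continuous_map_pairedI)
    from continuous_map_compose[OF continuous_map_compose[OF this cm] cs]
    show ?thesis by (simp add: o_def simps case_prod_unfold)
  qed
  moreover have "continuous_map TH' TH' (\<lambda>x. inv\<^bsub>H'\<^esub> x)"
  proof (rule continuous_map_eq[OF continuous_map_compose[OF continuous_map_compose[OF ct ci] cs]])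
    fix y assume "y \<in> topspace TH'"
    then obtain x where x: "x \<in> carrier H" "y = s x"
      by (auto simp: top' simps)
    have "inv\<^bsub>H'\<^esub> y = s (inv\<^bsub>H\<^esub> x)"
      using x by (intro group.inv_equality comm_group.axioms(2) cg) (auto simp: simps ts)
    then show "(s \<circ> ((\<lambda>x. inv\<^bsub>H\<^esub> x) \<circ> t)) y = inv\<^bsub>H'\<^esub> y"
      using x by (simp add: ts)
  qed
  ultimately have "abelian_topological_group H' TH'"
    using cg top' by (simp add: abelian_topological_group_def)
  moreover have "s \<in> hom H H'" "t \<in> hom H' H"
    by (auto simp: hom_def simps ts)
  ultimately show ?thesis
    using that cs ct ts by blast
qed

lemma abelian_topological_group_indiscrete:
  assumes "comm_group G"
  shows "abelian_topological_group G (topology (\<lambda>U. U = {} \<or> U = carrier G))"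
    and "topspace T = carrier A \<Longrightarrow> h \<in> carrier A \<rightarrow> carrier G \<Longrightarrow>
         continuous_map T (topology (\<lambda>U. U = {} \<or> U = carrier G)) h"
proof -
  let ?T = "topology (\<lambda>U. U = {} \<or> U = carrier G)"
  have "istopology (\<lambda>U. U = {} \<or> U = carrier G)"
    unfolding istopology_def by blast
  then have op: "openin ?T U \<longleftrightarrow> U = {} \<or> U = carrier G" for U
    by (simp add: topology_inverse')
  have top: "topspace ?T = carrier G"
    unfolding topspace_def op by blast
  have cont: "continuous_map S ?T h" if "h \<in> topspace S \<rightarrow> carrier G" for S :: "'z topology" and h
  proof -
    have "{x \<in> topspace S. h x \<in> carrier G} = topspace S"
      using that by blast
    then show ?thesis
      using that unfolding continuous_map_def by (auto simp: op top)
  qed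
  interpret comm_group G by fact
  show "abelian_topological_group G ?T"
    unfolding abelian_topological_group_def
    using assms by (auto simp: top intro!: cont)
  show "topspace T = carrier A \<Longrightarrow> h \<in> carrier A \<rightarrow> carrier G \<Longrightarrow> continuous_map T ?T h"
    by (rule cont) simp
qed

lemma free_abelian_topological_group_generate:
  fixes A :: "'g monoid"
  assumes free: "free_abelian_topological_group X A T i"
  shows "generate A (i ` topspace X) = carrier A"
proof -
  have A: "abelian_topological_group A T"
    and ext: "\<And>(H :: ('g \<times> nat) monoid) TH. abelian_topological_group H TH \<Longrightarrow>
         extends_uniquely X A T i H TH"
    using free by (auto simp: free_abelian_topological_group_def)
  interpret A: comm_group A
    using A by (simp add: abelian_topological_group_def)
  have top: "topspace T = carrier A"
    using A by (simp add: abelian_topological_group_def)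
  have emb: "continuous_map X T i"
    using free by (simp add: free_abelian_topological_group_def embedding_map_def
        homeomorphic_eq_everything_map continuous_map_in_subtopology)
  then have iX: "i ` topspace X \<subseteq> carrier A"
    using continuous_map_image_subset_topspace top by metis
  define B where "B = generate A (i ` topspace X)"
  have B: "subgroup B A"
    unfolding B_def by (rule A.generate_is_subgroup[OF iX])
  then have nB: "normal B A"
    by (rule A.subgroup_imp_normal)
  interpret nB: normal B A by (rule nB)
  define Q where "Q = A Mod B"
  have Q: "comm_group Q"
    unfolding Q_def by (rule A.abelian_FactGroup[OF B])
  interpret Q: comm_group Q by (rule Q)
  define TQ where "TQ = topology (\<lambda>U. U = {} \<or> U = carrier Q)"
  have TQ: "abelian_topological_group Q TQ"
    unfolding TQ_def by (rule abelian_topological_group_indiscrete(1)[OF Q])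
  define s :: "'g set \<Rightarrow> 'g \<times> nat" where "s = (\<lambda>C. (SOME x. x \<in> C, 0))"
  have inj: "inj_on s (carrier Q)"
  proof (rule inj_onI)
    fix C D assume CD: "C \<in> carrier Q" "D \<in> carrier Q" "s C = s D"
    have ne: "(SOME x. x \<in> C) \<in> C" if "C \<in> carrier Q" for C
      using that subgroup.rcosets_non_empty[OF B] unfolding Q_def FactGroup_def
      by (auto simp: some_in_eq)
    from ne[OF CD(1)] ne[OF CD(2)] CD(3) have "C \<inter> D \<noteq> {}"
      by (auto simp: s_def)
    then show "C = D"
      using CD(1,2) A.rcos_disjoint[OF B]
      unfolding Q_def FactGroup_def pairwise_def disjnt_def by auto
  qed
  obtain H' :: "('g \<times> nat) monoid" and TH' t where H':
    "abelian_topological_group H' TH'"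
    "s \<in> hom Q H'" "continuous_map TQ TH' s"
    "t \<in> hom H' Q" "continuous_map TH' TQ t"
    "\<And>x. x \<in> carrier Q \<Longrightarrow> t (s x) = x"
    using abelian_topological_group_transport[OF TQ inj] by metis
  interpret H': comm_group H'
    using H'(1) by (simp add: abelian_topological_group_def)
  have top': "topspace TH' = carrier H'"
    using H' by (simp add: abelian_topological_group_def)
  have r: "(\<lambda>a. B #>\<^bsub>A\<^esub> a) \<in> hom A Q"
    unfolding Q_def by (rule nB.r_coset_hom_Mod)
  have cr: "continuous_map T TQ (\<lambda>a. B #>\<^bsub>A\<^esub> a)"
    unfolding TQ_def
    by (rule abelian_topological_group_indiscrete(2)[OF Q top]) (use r in \<open>auto simp: hom_def\<close>)
  define p where "p = restrict (\<lambda>a. s (B #>\<^bsub>A\<^esub> a)) (carrier A)"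
  define q where "q = restrict (\<lambda>a. \<one>\<^bsub>H'\<^esub>) (carrier A)"
  have s1: "s \<one>\<^bsub>Q\<^esub> = \<one>\<^bsub>H'\<^esub>"
    using hom_one[OF H'(2)] Q.is_group H'.is_group by blast
  have B1: "B #>\<^bsub>A\<^esub> b = \<one>\<^bsub>Q\<^esub>" if "b \<in> B" for b
    using that B by (simp add: Q_def FactGroup_def A.coset_join2 subgroup.mem_carrier)
  have "continuous_map X TH' (\<lambda>x. \<one>\<^bsub>H'\<^esub>)"
    using top' by simp
  then have ex1: "\<exists>!h. h \<in> extensional (carrier A) \<and> h \<in> hom A H' \<and> continuous_map T TH' h \<and>
              (\<forall>x\<in>topspace X. h (i x) = \<one>\<^bsub>H'\<^esub>)"
    using ext[OF H'(1)] unfolding extends_uniquely_def by blast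
  have p: "p \<in> extensional (carrier A) \<and> p \<in> hom A H' \<and> continuous_map T TH' p \<and>
              (\<forall>x\<in>topspace X. p (i x) = \<one>\<^bsub>H'\<^esub>)"
  proof (intro conjI ballI)
    have "s \<circ> (\<lambda>a. B #>\<^bsub>A\<^esub> a) \<in> hom A H'"
      by (rule hom_compose[OF r H'(2)])
    then show "p \<in> hom A H'"
      by (auto simp: p_def hom_def Pi_iff)
    show "continuous_map T TH' p"
      by (rule continuous_map_eq[OF continuous_map_compose[OF cr H'(3)]])
        (simp add: p_def top)
    fix x assume "x \<in> topspace X"
    then have "i x \<in> B" "i x \<in> carrier A"
      using iX by (auto simp: B_def intro: generate.incl)
    then show "p (i x) = \<one>\<^bsub>H'\<^esub>"
      by (simp add: p_def B1 s1)
  qed (simp add: p_def)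
  have q: "q \<in> extensional (carrier A) \<and> q \<in> hom A H' \<and> continuous_map T TH' q \<and>
              (\<forall>x\<in>topspace X. q (i x) = \<one>\<^bsub>H'\<^esub>)"
  proof (intro conjI ballI)
    show "q \<in> hom A H'"
      by (auto simp: q_def hom_def)
    show "continuous_map T TH' q"
      by (rule continuous_map_eq[of _ _ "\<lambda>_. \<one>\<^bsub>H'\<^esub>"]) (auto simp: q_def top top')
  qed (use iX in \<open>auto simp: q_def\<close>)
  have "p = q"
    using ex1 p q by blast
  have "a \<in> B" if a: "a \<in> carrier A" for a
  proof -
    have "s (B #>\<^bsub>A\<^esub> a) = s \<one>\<^bsub>Q\<^esub>"
      using fun_cong[OF \<open>p = q\<close>, of a] a by (simp add: p_def q_def s1)
    moreover have "B #>\<^bsub>A\<^esub> a \<in> carrier Q"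
      using r a by (auto simp: hom_def)
    ultimately have "B #>\<^bsub>A\<^esub> a = \<one>\<^bsub>Q\<^esub>"
      using inj Q.one_closed by (auto dest: inj_onD)
    then show ?thesis
      using A.rcos_self[OF a B] by (simp add: Q_def FactGroup_def)
  qed
  then show ?thesis
    using B subgroup.subset unfolding B_def by blast
qed

lemma hom_eq_on_generate:
  assumes "group A" "group H" "g \<in> hom A H" "h \<in> hom A H" "Y \<subseteq> carrier A"
    and "\<And>y. y \<in> Y \<Longrightarrow> g y = h y" and "a \<in> generate A Y"
  shows "g a = h a"
proof -
  interpret g: group_hom A H g
    using assms by (simp add: group_hom_def group_hom_axioms_def)
  interpret h: group_hom A H h
    using assms by (simp add: group_hom_def group_hom_axioms_def)
  show ?thesis
    using assms(7)
  proof (induction rule: generate.induct)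
    case (eng a b)
    then have "a \<in> carrier A" "b \<in> carrier A"
      using g.G.generate_in_carrier[OF assms(5)] by auto
    then show ?case using eng by simp
  next
    case (inv y)
    then have "y \<in> carrier A" using assms(5) by blast
    then show ?case using assms(6)[OF inv] by simp
  qed (use assms(6) in auto)
qed

lemma generate_image_lepoll:
  fixes i :: "'a \<Rightarrow> 'g"
  assumes "group H" "f ` S \<subseteq> carrier H" "inj_on i S"
  shows "|generate H (f ` S)| \<le>o |UNIV :: ('g \<times> nat) set|"
proof -
  interpret group H by fact
  define y where "y = (\<lambda>(g, n :: nat). let z = f (inv_into S i g) in
    if n = 0 then z else inv\<^bsub>H\<^esub> z)"
  define w where "w = (\<lambda>l. foldr (\<lambda>a z. y a \<otimes>\<^bsub>H\<^esub> z) l \<one>\<^bsub>H\<^esub>)"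
  let ?L = "lists ((i ` S) \<times> UNIV)"
  have y: "y a \<in> carrier H" if "a \<in> (i ` S) \<times> UNIV" for a
    using that assms by (auto simp: y_def Let_def)
  have wc: "w l \<in> carrier H" if "l \<in> ?L" for l
    using that by (induction l) (auto simp: w_def intro!: y)
  have wapp: "w (l @ m) = w l \<otimes>\<^bsub>H\<^esub> w m" if "l \<in> ?L" "m \<in> ?L" for l m
    using that(1)
  proof (induction l)
    case Nil
    then show ?case using wc[OF that(2)] by (simp add: w_def)
  next
    case (Cons a l)
    have "w ((a # l) @ m) = y a \<otimes>\<^bsub>H\<^esub> w (l @ m)" "w (a # l) = y a \<otimes>\<^bsub>H\<^esub> w l"
      by (simp_all add: w_def)
    then show ?case
      using Cons y[OF Cons.hyps(1)] wc[OF Cons.hyps(2)] wc[OF that(2)] by (simp add: m_assoc)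
  qed
  have "a \<in> w ` ?L" if "a \<in> generate H (f ` S)" for a
    using that
  proof (induction rule: generate.induct)
    case one
    have "w [] = \<one>\<^bsub>H\<^esub>" by (simp add: w_def)
    then show ?case by (metis imageI lists.Nil)
  next
    case (incl z)
    then obtain x where x: "x \<in> S" "z = f x" by blast
    then have "w [(i x, 0)] = z"
      using assms by (auto simp: w_def y_def Let_def)
    moreover have "[(i x, 0)] \<in> ?L" using x by simp
    ultimately show ?case by blast
  next
    case (inv z)
    then obtain x where x: "x \<in> S" "z = f x" by blast
    then have "w [(i x, 1)] = inv\<^bsub>H\<^esub> z"
      using assms by (auto simp: w_def y_def Let_def)
    moreover have "[(i x, 1)] \<in> ?L" using x by simp
    ultimately show ?case by (metis imageI)
  next
    case (eng a b)
    then obtain l m where "l \<in> ?L" "a = w l" "m \<in> ?L" "b = w m" by auto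
    then have "a \<otimes>\<^bsub>H\<^esub> b = w (l @ m)" "l @ m \<in> ?L"
      by (auto simp: wapp)
    then show ?case by (metis imageI)
  qed
  then have "generate H (f ` S) \<subseteq> w ` (UNIV :: ('g \<times> nat) list set)"
    by blast
  then have "|generate H (f ` S)| \<le>o |UNIV :: ('g \<times> nat) list set|"
    using surj_imp_ordLeq by blast
  moreover have "|UNIV :: ('g \<times> nat) list set| =o |UNIV :: ('g \<times> nat) set|"
    using card_of_lists_infinite[of "UNIV :: ('g \<times> nat) set"]
    by (simp add: finite_prod)
  ultimately show ?thesis
    using ordLeq_ordIso_trans by blast
qed

theorem free_abelian_topological_group_extends:
  fixes A :: "'g monoid" and H :: "'h monoid"
  assumes free: "free_abelian_topological_group X A T i"
    and H: "abelian_topological_group H TH"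
  shows "extends_uniquely X A T i H TH"
  unfolding extends_uniquely_def
proof (intro allI impI)
  fix f assume f: "continuous_map X TH f"
  have A: "abelian_topological_group A T"
    and ext: "\<And>(H :: ('g \<times> nat) monoid) TH. abelian_topological_group H TH \<Longrightarrow>
         extends_uniquely X A T i H TH"
    and emb: "embedding_map X T i"
    using free by (auto simp: free_abelian_topological_group_def)
  interpret A: comm_group A
    using A by (simp add: abelian_topological_group_def)
  interpret H: comm_group H
    using H by (simp add: abelian_topological_group_def)
  have top: "topspace T = carrier A" and topH: "topspace TH = carrier H"
    using A H by (auto simp: abelian_topological_group_def)
  have iX: "i ` topspace X \<subseteq> carrier A"
  proof -
    have "continuous_map X T i"
      using emb by (simp add: embedding_map_def homeomorphic_eq_everything_map
          continuous_map_in_subtopology)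
    then show ?thesis
      using continuous_map_image_subset_topspace top by metis
  qed
  have fX: "f ` topspace X \<subseteq> carrier H"
    using f continuous_map_image_subset_topspace topH by metis
  have inji: "inj_on i (topspace X)"
    using emb by (simp add: embedding_map_def homeomorphic_imp_injective_map)
  define S where "S = generate H (f ` topspace X)"
  have S: "subgroup S H"
    unfolding S_def by (rule H.generate_is_subgroup[OF fX])
  then have SH: "S \<subseteq> carrier H" by (rule subgroup.subset)
  define G where "G = H\<lparr>carrier := S\<rparr>"
  define TG where "TG = subtopology TH S"
  have G: "abelian_topological_group G TG"
    unfolding abelian_topological_group_def
  proof (intro conjI)
    have "x \<otimes>\<^bsub>H\<^esub> y = y \<otimes>\<^bsub>H\<^esub> x" if "x \<in> S" "y \<in> S" for x y
      using that SH by (intro H.m_comm) blast+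
    then show "comm_group G"
      unfolding G_def by (intro group.group_comm_groupI[OF H.subgroup_imp_group[OF S]]) simp
    show topG: "topspace TG = carrier G"
      using SH by (simp add: TG_def G_def topH Int_absorb1)
    then have topS: "topspace TG = S"
      by (simp add: G_def)
    have "continuous_map (prod_topology TG TG) TH (\<lambda>(x, y). x \<otimes>\<^bsub>H\<^esub> y)"
      using H unfolding TG_def abelian_topological_group_def subtopology_Times[symmetric]
      by (intro continuous_map_from_subtopology) blast
    moreover have "(\<lambda>(x, y). x \<otimes>\<^bsub>H\<^esub> y) \<in> S \<times> S \<rightarrow> S"
      using subgroup.m_closed[OF S] by auto
    ultimately have "continuous_map (prod_topology TG TG) (subtopology TH S) (\<lambda>(x, y). x \<otimes>\<^bsub>H\<^esub> y)"
      unfolding continuous_map_in_subtopology topspace_prod_topology topS by blast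
    then show "continuous_map (prod_topology TG TG) TG (\<lambda>(x, y). x \<otimes>\<^bsub>G\<^esub> y)"
      by (simp add: G_def flip: TG_def)
    have "continuous_map TG TH (\<lambda>x. inv\<^bsub>H\<^esub> x)"
      using H unfolding TG_def abelian_topological_group_def
      by (intro continuous_map_from_subtopology) blast
    moreover have "(\<lambda>x. inv\<^bsub>H\<^esub> x) \<in> S \<rightarrow> S"
      by (rule Pi_I) (rule subgroup.m_inv_closed[OF S])
    ultimately have "continuous_map TG (subtopology TH S) (\<lambda>x. inv\<^bsub>H\<^esub> x)"
      unfolding continuous_map_in_subtopology topS by blast
    then have "continuous_map TG TG (\<lambda>x. inv\<^bsub>H\<^esub> x)"
      by (simp flip: TG_def)
    then show "continuous_map TG TG (\<lambda>x. inv\<^bsub>G\<^esub> x)"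
      by (rule continuous_map_eq) (metis topS G_def H.m_inv_consistent[OF S])
  qed
  have "|carrier G| \<le>o |UNIV :: ('g \<times> nat) set|"
    using generate_image_lepoll[OF H.is_group fX inji] by (simp add: G_def S_def)
  then obtain s :: "'h \<Rightarrow> 'g \<times> nat" where inj: "inj_on s (carrier G)"
    unfolding card_of_ordLeq[symmetric] by blast
  obtain H' :: "('g \<times> nat) monoid" and TH' t where H':
    "abelian_topological_group H' TH'"
    "s \<in> hom G H'" "continuous_map TG TH' s"
    "t \<in> hom H' G" "continuous_map TH' TG t"
    "\<And>x. x \<in> carrier G \<Longrightarrow> t (s x) = x"
    using abelian_topological_group_transport[OF G inj] by metis
  have fS: "f x \<in> carrier G" if "x \<in> topspace X" for x
    using that by (auto simp: G_def S_def intro: generate.incl)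
  have "continuous_map X TG f"
    using f fS by (auto simp: TG_def G_def continuous_map_in_subtopology)
  then have "continuous_map X TH' (s \<circ> f)"
    using H'(3) continuous_map_compose by blast
  then obtain h where h: "h \<in> hom A H'" "continuous_map T TH' h"
    "\<And>x. x \<in> topspace X \<Longrightarrow> h (i x) = s (f x)"
    using ext[OF H'(1)] unfolding extends_uniquely_def by (metis comp_apply)
  define k where "k = restrict (t \<circ> h) (carrier A)"
  show "\<exists>!h. h \<in> extensional (carrier A) \<and> h \<in> hom A H \<and> continuous_map T TH h \<and>
              (\<forall>x\<in>topspace X. h (i x) = f x)"
  proof (rule ex1I[of _ k])
    have "t \<circ> h \<in> hom A G"
      by (rule hom_compose[OF h(1) H'(4)])
    then have "k \<in> hom A H"
      using SH by (auto simp: k_def hom_def G_def Pi_iff)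
    moreover have "continuous_map T TH (t \<circ> h)"
      using continuous_map_compose[OF h(2) H'(5)] by (simp add: TG_def continuous_map_in_subtopology)
    then have "continuous_map T TH k"
      by (rule continuous_map_eq) (simp add: k_def top)
    moreover have "k (i x) = f x" if "x \<in> topspace X" for x
      using that iX h(3) H'(6) fS by (auto simp: k_def)
    ultimately show k: "k \<in> extensional (carrier A) \<and> k \<in> hom A H \<and> continuous_map T TH k \<and>
              (\<forall>x\<in>topspace X. k (i x) = f x)"
      by (simp add: k_def)
    fix g assume g: "g \<in> extensional (carrier A) \<and> g \<in> hom A H \<and> continuous_map T TH g \<and>
              (\<forall>x\<in>topspace X. g (i x) = f x)"
    show "g = k"
    proof (rule extensionalityI)
      show "g \<in> extensional (carrier A)" "k \<in> extensional (carrier A)"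
        using g k by blast+
      fix a assume "a \<in> carrier A"
      then have "a \<in> generate A (i ` topspace X)"
        using free_abelian_topological_group_generate[OF free] by simp
      moreover have "g y = k y" if "y \<in> i ` topspace X" for y
        using that g k by auto
      ultimately show "g a = k a"
        using hom_eq_on_generate[OF A.is_group H.is_group _ _ iX, of g k] g k by blast
    qed
  qed
qed

end

theory Submission
  imports Defs
begin

text \<open>
  Group topologies on \<open>A\<close> are produced from filtrations \<open>W 0 \<supseteq> W 1 \<supseteq> \<dots>\<close> of symmetric sets
  with \<open>W (m + 1)\<^sup>2 \<subseteq> W m\<close>; if such a topology makes \<open>i\<close> continuous, then \<open>W 0\<close> is a
  neighbourhood of the identity by the universal property.

  Lower bounds: for continuous functions \<open>f k\<close> from \<open>X\<close> to \<open>[0, 1]\<close> and \<open>c k \<longlonglongrightarrow> \<infinity>\<close> there is a neighbourhood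
  of the identity on which the homomorphism extending \<open>f k\<close> is bounded by \<open>c k\<close>. Choosing functions that
  vanish at a cluster point of a sequence in an infinite compact set yields a dominating family from
  every local base. On the other hand, a neighbourhood bounds the extensions of only countably many
  members of a uniformly separated family of functions. The maximal such families on the \<open>K n\<close> have
  together at least \<open>\<kappa>\<close> members, and every countable set of them is bounded on some neighbourhood.

  Upper bound: a neighbourhood of the identity contains a filtration of open sets. On each compact set
  it is controlled at each level by a finite cover from a base of size at most \<open>\<kappa>\<close>. A countable set
  of codes for these covers and a function in \<open>\<nat>\<^sup>\<nat>\<close> locating them in an enumeration determine a
  basic neighbourhood.
\<close>

section \<open>Group topologies from filtrations\<close>

definition additive_reals :: "real monoid" where
  "additive_reals = \<lparr>carrier = UNIV, monoid.mult = (+), one = 0\<rparr>"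

lemma additive_reals_simps [simp]:
  "carrier additive_reals = UNIV" "x \<otimes>\<^bsub>additive_reals\<^esub> y = x + y" "\<one>\<^bsub>additive_reals\<^esub> = 0"
  by (simp_all add: additive_reals_def)

lemma comm_group_additive_reals: "comm_group additive_reals"
  by (rule comm_groupI) (auto intro: exI[of _ "- _"])

lemma inv_additive_reals [simp]: "inv\<^bsub>additive_reals\<^esub> x = - x"
  by (rule group.inv_equality) (use comm_group_additive_reals in \<open>auto simp: comm_group_def\<close>)

lemma abelian_topological_group_additive_reals:
  "abelian_topological_group additive_reals euclidean"
  unfolding abelian_topological_group_def
  using comm_group_additive_reals
  by (auto simp: case_prod_unfold intro!: continuous_intros)

text \<open>A set is declared open if with each point \<open>a\<close> it contains some translate of
  a \<open>W m\<close> by \<open>a\<close>. The \<open>W m\<close> need not be open themselves, so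
  the argument works with the interiors of their translates; the condition on products of two
  elements of \<open>W (Suc m)\<close> shows that these interiors are open.\<close>

lemma group_topology_of_filtration:
  fixes G (structure) and W :: "nat \<Rightarrow> 'g set"
  assumes "comm_group G"
    and W: "\<And>m. W m \<subseteq> carrier G" "\<And>m. \<one> \<in> W m" "\<And>m a. a \<in> W m \<Longrightarrow> inv a \<in> W m"
      "\<And>m a b. a \<in> W (Suc m) \<Longrightarrow> b \<in> W (Suc m) \<Longrightarrow> a \<otimes> b \<in> W m"
  shows "\<exists>S. abelian_topological_group G S \<and>
    (\<forall>U. openin S U \<longleftrightarrow> U \<subseteq> carrier G \<and> (\<forall>a\<in>U. \<exists>m. \<forall>w\<in>W m. a \<otimes> w \<in> U)) \<and>
    (\<exists>V. openin S V \<and> \<one> \<in> V \<and> V \<subseteq> W 0)"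
proof -
  interpret comm_group G by fact
  define P where "P = (\<lambda>U. U \<subseteq> carrier G \<and> (\<forall>a\<in>U. \<exists>m. \<forall>w\<in>W m. a \<otimes> w \<in> U))"
  have Wc: "w \<in> carrier G" if "w \<in> W m" for w m
    using W(1) that by blast
  have Suc_sub: "W (Suc m) \<subseteq> W m" for m
    using W(4)[OF _ W(2)] Wc by fastforce
  have anti: "W n \<subseteq> W m" if "m \<le> n" for m n
    using Suc_sub that by (rule lift_Suc_antimono_le)
  have "istopology P"
    unfolding istopology_def
  proof (intro conjI allI impI)
    fix U V assume UV: "P U" "P V"
    show "P (U \<inter> V)"
      unfolding P_def
    proof (intro conjI ballI)
      fix a assume a: "a \<in> U \<inter> V"
      then obtain m n where "\<forall>w\<in>W m. a \<otimes> w \<in> U" "\<forall>w\<in>W n. a \<otimes> w \<in> V"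
        using UV unfolding P_def by blast
      then have "\<forall>w\<in>W (max m n). a \<otimes> w \<in> U \<inter> V"
        using anti by (meson IntI max.cobounded1 max.cobounded2 subsetD)
      then show "\<exists>m. \<forall>w\<in>W m. a \<otimes> w \<in> U \<inter> V" ..
    qed (use UV in \<open>auto simp: P_def\<close>)
  next
    fix \<K> assume "\<forall>U\<in>\<K>. P U"
    then show "P (\<Union>\<K>)"
      unfolding P_def by (meson Union_iff Union_least)
  qed
  define S where "S = topology P"
  have op: "openin S U \<longleftrightarrow> U \<subseteq> carrier G \<and> (\<forall>a\<in>U. \<exists>m. \<forall>w\<in>W m. a \<otimes> w \<in> U)" for U
    using \<open>istopology P\<close> by (simp add: S_def P_def topology_inverse')
  have top: "topspace S = carrier G"
  proof (rule subset_antisym)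
    show "topspace S \<subseteq> carrier G"
      using iffD1[OF op openin_topspace] by blast
    have "openin S (carrier G)"
      unfolding op using Wc by blast
    then show "carrier G \<subseteq> topspace S"
      by (rule openin_subset)
  qed
  \<comment> \<open>The interior of the translate of \<open>W m\<close> by \<open>a\<close>: the
    points \<open>b\<close> for which some translate of \<open>W k\<close> by \<open>b\<close> stays
    inside it.\<close>
  define N where "N = (\<lambda>a m. {b \<in> carrier G. \<exists>k. \<forall>w\<in>W k. inv a \<otimes> b \<otimes> w \<in> W m})"
  have N: "openin S (N a m)" "a \<in> N a m" "b \<in> N a m \<Longrightarrow> inv a \<otimes> b \<in> W m"
    if a: "a \<in> carrier G" for a b m
  proof -
    show "a \<in> N a m"
      using a Wc by (auto simp: N_def intro!: exI[of _ m])
    show "inv a \<otimes> b \<in> W m" if b: "b \<in> N a m"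
    proof -
      obtain k where "\<forall>w\<in>W k. inv a \<otimes> b \<otimes> w \<in> W m" using b unfolding N_def by blast
      then have "inv a \<otimes> b \<otimes> \<one> \<in> W m" using W(2) by blast
      then show ?thesis using a b by (simp add: N_def)
    qed
    have "\<exists>k. \<forall>w\<in>W k. b \<otimes> w \<in> N a m" if b: "b \<in> N a m" for b
    proof -
      obtain k where bc: "b \<in> carrier G" and k: "\<forall>w\<in>W k. inv a \<otimes> b \<otimes> w \<in> W m"
        using b unfolding N_def by blast
      have "b \<otimes> v \<in> N a m" if v: "v \<in> W (Suc k)" for v
        unfolding N_def
      proof (intro CollectI conjI exI ballI)
        show "b \<otimes> v \<in> carrier G" using bc v Wc by blast
        fix w assume w: "w \<in> W (Suc k)"
        have "inv a \<otimes> (b \<otimes> v) \<otimes> w = inv a \<otimes> b \<otimes> (v \<otimes> w)"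
          using a bc Wc[OF v] Wc[OF w] by (simp add: m_assoc)
        then show "inv a \<otimes> (b \<otimes> v) \<otimes> w \<in> W m"
          using k W(4)[OF v w] by simp
      qed
      then show ?thesis by blast
    qed
    moreover have "N a m \<subseteq> carrier G" by (auto simp: N_def)
    ultimately show "openin S (N a m)"
      unfolding op by blast
  qed
  have "continuous_map (prod_topology S S) S (\<lambda>(x, y). x \<otimes> y)"
    unfolding continuous_map_def
  proof (intro conjI allI impI)
    fix U assume U: "openin S U"
    let ?D = "{p \<in> topspace (prod_topology S S). (case p of (x, y) \<Rightarrow> x \<otimes> y) \<in> U}"
    show "openin (prod_topology S S) ?D"
      unfolding openin_prod_topology_alt
    proof (intro allI impI)
      fix x y assume "(x, y) \<in> ?D"
      then have xy: "x \<in> carrier G" "y \<in> carrier G" "x \<otimes> y \<in> U"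
        by (auto simp: top)
      then obtain m where m: "\<forall>w\<in>W m. x \<otimes> y \<otimes> w \<in> U"
        using U unfolding op by blast
      have "a \<otimes> b \<in> U" if "a \<in> N x (Suc m)" "b \<in> N y (Suc m)" for a b
      proof -
        have c: "a \<in> carrier G" "b \<in> carrier G" using that by (auto simp: N_def)
        have "(inv x \<otimes> a) \<otimes> (inv y \<otimes> b) \<in> W m"
          by (intro W(4) N(3) that xy)
        \<comment> \<open>Commutativity enters here: it brings \<open>x\<close> next to
          \<open>inv x\<close> and \<open>y\<close> next to \<open>inv y\<close>.\<close>
        moreover have "x \<otimes> y \<otimes> ((inv x \<otimes> a) \<otimes> (inv y \<otimes> b)) = (x \<otimes> inv x) \<otimes> (y \<otimes> inv y) \<otimes> (a \<otimes> b)"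
          using xy c by (simp add: m_ac del: r_inv l_inv)
        then have "x \<otimes> y \<otimes> ((inv x \<otimes> a) \<otimes> (inv y \<otimes> b)) = a \<otimes> b"
          using xy c by simp
        ultimately show ?thesis using m by metis
      qed
      then have "N x (Suc m) \<times> N y (Suc m) \<subseteq> ?D"
        by (auto simp: top N_def)
      then show "\<exists>V V'. openin S V \<and> openin S V' \<and> x \<in> V \<and> y \<in> V' \<and> V \<times> V' \<subseteq> ?D"
        using N(1,2)[OF xy(1), of "Suc m"] N(1,2)[OF xy(2), of "Suc m"] by blast
    qed
  qed (auto simp: top)
  moreover have "continuous_map S S (\<lambda>x. inv x)"
    unfolding continuous_map_def
  proof (intro conjI allI impI)
    fix U assume U: "openin S U"
    show "openin S {x \<in> topspace S. inv x \<in> U}"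
      unfolding op
    proof (intro conjI ballI)
      fix a assume "a \<in> {x \<in> topspace S. inv x \<in> U}"
      then have a: "a \<in> carrier G" "inv a \<in> U" by (auto simp: top)
      then obtain m where m: "\<forall>w\<in>W m. inv a \<otimes> w \<in> U"
        using U unfolding op by blast
      have "inv (a \<otimes> w) \<in> U" if "w \<in> W m" for w
        using m W(3)[OF that] a Wc[OF that] by (simp add: inv_mult)
      then show "\<exists>m. \<forall>w\<in>W m. a \<otimes> w \<in> {x \<in> topspace S. inv x \<in> U}"
        using a Wc by (auto simp: top)
    qed (auto simp: top)
  qed (auto simp: top)
  ultimately have "abelian_topological_group G S"
    unfolding abelian_topological_group_def top using \<open>comm_group G\<close> by simp
  have "N \<one> 0 \<subseteq> W 0"
  proof
    fix b assume b: "b \<in> N \<one> 0"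
    then have "b \<in> carrier G" by (simp add: N_def)
    then show "b \<in> W 0" using N(3)[OF one_closed b] by simp
  qed
  then have "\<exists>V. openin S V \<and> \<one> \<in> V \<and> V \<subseteq> W 0"
    using N(1,2)[OF one_closed, of 0] by blast
  with \<open>abelian_topological_group G S\<close> op show ?thesis
    by (intro exI[of _ S]) simp
qed

section \<open>Free abelian topological groups and extensions to the reals\<close>

locale free_abelian_top_group =
  fixes X :: "'a topology" and A :: "'g monoid" (structure) and T :: "'g topology" and i :: "'a \<Rightarrow> 'g"
  assumes free: "free_abelian_topological_group X A T i"
begin

lemma abelian_topological_group: "abelian_topological_group A T"
  and embedding: "embedding_map X T i"
  using free by (auto simp: free_abelian_topological_group_def)

sublocale comm_group A
  using abelian_topological_group by (simp add: abelian_topological_group_def)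

lemma topspace_eq: "topspace T = carrier A"
  using abelian_topological_group by (simp add: abelian_topological_group_def)

lemma continuous_i: "continuous_map X T i"
  using embedding by (simp add: embedding_map_def homeomorphic_eq_everything_map
      continuous_map_in_subtopology)

lemma i_closed [simp]: "x \<in> topspace X \<Longrightarrow> i x \<in> carrier A"
  using continuous_i topspace_eq continuous_map_image_subset_topspace by blast

lemma continuous_mult:
  "continuous_map Y T f \<Longrightarrow> continuous_map Y T g \<Longrightarrow> continuous_map Y T (\<lambda>y. f y \<otimes> g y)"
  using continuous_map_compose[OF continuous_map_pairedI, of Y T f T g T "\<lambda>(a, b). a \<otimes> b"]
    abelian_topological_group by (simp add: abelian_topological_group_def o_def)

lemma continuous_inv: "continuous_map T T (\<lambda>a. inv a)"
  using abelian_topological_group by (simp add: abelian_topological_group_def)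

text \<open>The homomorphism to the reals supplied by the universal property. It is meant for
  continuous \<open>f\<close>, and its values are determined on \<open>carrier A\<close>
  only.\<close>

definition real_extension :: "('a \<Rightarrow> real) \<Rightarrow> 'g \<Rightarrow> real" where
  "real_extension f = (SOME h. h \<in> hom A additive_reals \<and> (\<forall>x\<in>topspace X. h (i x) = f x))"

context
  fixes f :: "'a \<Rightarrow> real"
  assumes f: "continuous_map X euclidean f"
begin

lemma real_extension:
  "real_extension f \<in> hom A additive_reals" "x \<in> topspace X \<Longrightarrow> real_extension f (i x) = f x"
proof -
  have "\<exists>h. h \<in> hom A additive_reals \<and> (\<forall>x\<in>topspace X. h (i x) = f x)"
    using free_abelian_topological_group_extends[OF free abelian_topological_group_additive_reals] f
    unfolding extends_uniquely_def by blast
  from someI_ex[OF this]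
  show "real_extension f \<in> hom A additive_reals" "x \<in> topspace X \<Longrightarrow> real_extension f (i x) = f x"
    unfolding real_extension_def by auto
qed

lemma real_extension_group_hom: "group_hom A additive_reals (real_extension f)"
  using real_extension(1) comm_group_additive_reals
  by (intro group_hom.intro group_hom_axioms.intro) (auto simp: comm_group_def is_group)

lemma real_extension_mult:
  "a \<in> carrier A \<Longrightarrow> b \<in> carrier A \<Longrightarrow> real_extension f (a \<otimes> b) = real_extension f a + real_extension f b"
  using group_hom.hom_mult[OF real_extension_group_hom] by simp

lemma real_extension_one: "real_extension f \<one> = 0"
  using group_hom.hom_one[OF real_extension_group_hom] by simp

lemma real_extension_inv: "a \<in> carrier A \<Longrightarrow> real_extension f (inv a) = - real_extension f a"
  using group_hom.hom_inv[OF real_extension_group_hom] by simp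

lemma real_extension_pow:
  "a \<in> carrier A \<Longrightarrow> real_extension f (a [^] (n :: nat)) = real n * real_extension f a"
  by (induction n) (simp_all add: real_extension_one real_extension_mult algebra_simps)

end

text \<open>The topology \<open>S\<close> of the filtration makes \<open>i\<close> continuous, since
  openness in \<open>X\<close> can be tested on the members of \<K>. So \<open>i\<close> extends to
  a continuous homomorphism from \<open>A\<close> with \<open>T\<close> to \<open>A\<close> with
  \<open>S\<close>. It fixes the generators \<open>i x\<close>, hence is the identity; thus
  \<open>T\<close> is finer than \<open>S\<close>.\<close>

lemma filtration_neighbourhood:
  fixes W :: "nat \<Rightarrow> 'g set"
  assumes W: "\<And>m. W m \<subseteq> carrier A" "\<And>m. \<one> \<in> W m" "\<And>m a. a \<in> W m \<Longrightarrow> inv a \<in> W m"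
      "\<And>m a b. a \<in> W (Suc m) \<Longrightarrow> b \<in> W (Suc m) \<Longrightarrow> a \<otimes> b \<in> W m"
    and K: "\<And>U. U \<subseteq> topspace X \<Longrightarrow> (\<And>K. K \<in> \<K> \<Longrightarrow> openin (subtopology X K) (U \<inter> K)) \<Longrightarrow> openin X U"
    and loc: "\<And>K x m. K \<in> \<K> \<Longrightarrow> x \<in> K \<Longrightarrow> x \<in> topspace X \<Longrightarrow>
      \<exists>V. openin (subtopology X K) V \<and> x \<in> V \<and> (\<forall>y\<in>V. inv (i x) \<otimes> i y \<in> W m)"
  obtains V where "openin T V" "\<one> \<in> V" "V \<subseteq> W 0"
proof -
  obtain S where S: "abelian_topological_group A S"
    and op: "\<And>U. openin S U \<longleftrightarrow> U \<subseteq> carrier A \<and> (\<forall>a\<in>U. \<exists>m. \<forall>w\<in>W m. a \<otimes> w \<in> U)"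
    and ex: "\<exists>V. openin S V \<and> \<one> \<in> V \<and> V \<subseteq> W 0"
    using group_topology_of_filtration[where W = W, OF comm_group_axioms W] by metis
  from ex obtain V where V: "openin S V" "\<one> \<in> V" "V \<subseteq> W 0" by blast
  have topS: "topspace S = carrier A"
    using S by (simp add: abelian_topological_group_def)
  have "continuous_map X S i"
    unfolding continuous_map_def
  proof (intro conjI allI impI)
    fix U assume U: "openin S U"
    show "openin X {x \<in> topspace X. i x \<in> U}"
    proof (rule K)
      fix K assume "K \<in> \<K>"
      show "openin (subtopology X K) ({x \<in> topspace X. i x \<in> U} \<inter> K)"
      proof (subst openin_subopen, intro ballI)
        fix x assume x: "x \<in> {x \<in> topspace X. i x \<in> U} \<inter> K"
        then obtain m where m: "\<forall>w\<in>W m. i x \<otimes> w \<in> U"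
          using U unfolding op by blast
        obtain V where V: "openin (subtopology X K) V" "x \<in> V" "\<forall>y\<in>V. inv (i x) \<otimes> i y \<in> W m"
          using loc[OF \<open>K \<in> \<K>\<close>, of x m] x by blast
        have "y \<in> {x \<in> topspace X. i x \<in> U} \<inter> K" if y: "y \<in> V" for y
        proof -
          have yX: "y \<in> topspace X" "y \<in> K"
            using openin_subset[OF V(1)] y by auto
          have "i x \<otimes> (inv (i x) \<otimes> i y) = i y"
            using x yX by (simp add: m_assoc[symmetric])
          then show ?thesis using m V(3) y yX by force
        qed
        then show "\<exists>V. openin (subtopology X K) V \<and> x \<in> V \<and> V \<subseteq> {x \<in> topspace X. i x \<in> U} \<inter> K"
          using V by blast
      qed
    qed auto
  qed (auto simp: topS)
  then obtain h where h: "h \<in> hom A A" "continuous_map T S h" "\<And>x. x \<in> topspace X \<Longrightarrow> h (i x) = i x"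
    using free_abelian_topological_group_extends[OF free S] unfolding extends_uniquely_def by blast
  have hid: "h a = a" if "a \<in> carrier A" for a
    by (rule hom_eq_on_generate[of A A h "\<lambda>a. a" "i ` topspace X", OF is_group is_group h(1)])
      (use h(3) that free_abelian_topological_group_generate[OF free] in \<open>auto simp: hom_def\<close>)
  have "openin T {a \<in> topspace T. h a \<in> V}"
    using h(2) V(1) by (rule openin_continuous_map_preimage)
  moreover have "{a \<in> topspace T. h a \<in> V} = V"
    using openin_subset[OF V(1)] hid by (auto simp: topspace_eq topS)
  ultimately show ?thesis using that V by simp
qed

end

section \<open>The dominating number as a lower bound\<close>

lemma min_card_Card_order: "Card_order (min_card P)"
  unfolding min_card_def by (rule card_of_Card_order)

lemma min_card_le: "P B \<Longrightarrow> min_card P \<le>o |B|"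
  by (rule min_card[of P B]) auto

section \<open>Neighbourhoods on which extensions are bounded\<close>

context free_abelian_top_group
begin

text \<open>The sets \<open>W m\<close>, with the bounds \<open>c k / 2 ^ m\<close>, form a
  filtration. Near a point only the finitely many \<open>k\<close> with \<open>c k < 2 ^ m\<close>
  impose a condition, because the values of each \<open>f k\<close> differ by at most 1.\<close>

lemma bounded_neighbourhood:
  fixes f :: "nat \<Rightarrow> 'a \<Rightarrow> real"
  assumes f: "\<And>k. continuous_map X euclidean (f k)"
    and f01: "\<And>k x. x \<in> topspace X \<Longrightarrow> f k x \<in> {0..1}"
    and c: "\<And>k. c k > 0" "filterlim c at_top sequentially"
  shows "\<exists>V. openin T V \<and> \<one> \<in> V \<and> (\<forall>a\<in>V. \<forall>k. \<bar>real_extension (f k) a\<bar> \<le> c k)"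
proof -
  define W where "W = (\<lambda>m :: nat. {a \<in> carrier A. \<forall>k. \<bar>real_extension (f k) a\<bar> \<le> c k / 2 ^ m})"
  have loc: "\<exists>V. openin X V \<and> x \<in> V \<and> (\<forall>y\<in>V. inv (i x) \<otimes> i y \<in> W m)" if x: "x \<in> topspace X" for x m
  proof -
    obtain k0 where k0: "\<And>k. k \<ge> k0 \<Longrightarrow> c k \<ge> 2 ^ m"
      using c(2) unfolding filterlim_at_top eventually_sequentially by meson
    define O' where "O' = (\<lambda>k. {y \<in> topspace X. \<bar>f k y - f k x\<bar> \<in> {..<c k / 2 ^ m}})"
    have "openin X (O' k)" for k
      unfolding O'_def
      by (rule openin_continuous_map_preimage[where Y = euclidean]) (use f in \<open>auto intro!: continuous_intros\<close>)
    then have "openin X (topspace X \<inter> (\<Inter>k\<in>{..<k0}. O' k))"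
      by (intro openin_Int_Inter) auto
    moreover have "x \<in> topspace X \<inter> (\<Inter>k\<in>{..<k0}. O' k)"
      using x c(1) by (auto simp: O'_def)
    moreover have "inv (i x) \<otimes> i y \<in> W m" if y: "y \<in> topspace X \<inter> (\<Inter>k\<in>{..<k0}. O' k)" for y
    proof -
      have yX: "y \<in> topspace X" using y by blast
      have "\<bar>f k y - f k x\<bar> \<le> c k / 2 ^ m" for k
      proof (cases "k < k0")
        case True
        then show ?thesis using y by (auto simp: O'_def less_imp_le)
      next
        case False
        then have "1 \<le> c k / 2 ^ m" using k0[of k] by (simp add: field_simps)
        moreover have "\<bar>f k y - f k x\<bar> \<le> 1" using f01[OF x, of k] f01[OF yX, of k] by auto
        ultimately show ?thesis by linarith
      qed
      then show ?thesis
        using x yX by (simp add: W_def real_extension_mult f real_extension_inv real_extension)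
    qed
    ultimately show ?thesis by blast
  qed
  have "\<exists>V. openin T V \<and> \<one> \<in> V \<and> V \<subseteq> W 0"
  proof (rule filtration_neighbourhood[where W = W and \<K> = "{topspace X}"])
    show "\<exists>V. openin (subtopology X K) V \<and> x \<in> V \<and> (\<forall>y\<in>V. inv (i x) \<otimes> i y \<in> W m)"
      if "K \<in> {topspace X}" "x \<in> topspace X" for K x m
      using loc[OF that(2)] that(1) by simp
    show "openin X U" if "\<And>K. K \<in> {topspace X} \<Longrightarrow> openin (subtopology X K) (U \<inter> K)" "U \<subseteq> topspace X" for U
      using that by (auto simp: Int_absorb2)
    show "\<one> \<in> W m" for m
      using c(1) by (auto simp: W_def real_extension_one f less_imp_le)
    show "inv a \<in> W m" if "a \<in> W m" for m a
      using that by (auto simp: W_def real_extension_inv f)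
    show "a \<otimes> b \<in> W m" if "a \<in> W (Suc m)" "b \<in> W (Suc m)" for m a b
    proof -
      have "\<bar>real_extension (f k) a + real_extension (f k) b\<bar> \<le> c k / 2 ^ m" for k
      proof -
        have "2 * \<bar>real_extension (f k) a\<bar> \<le> c k / 2 ^ m" "2 * \<bar>real_extension (f k) b\<bar> \<le> c k / 2 ^ m"
          using that by (auto simp: W_def field_simps)
        then show ?thesis
          using abs_triangle_ineq[of "real_extension (f k) a" "real_extension (f k) b"] by linarith
      qed
      then show ?thesis
        using that by (auto simp: W_def real_extension_mult f)
    qed
  qed (auto simp: W_def)
  then show ?thesis
    unfolding W_def by auto
qed

text \<open>If the extension of \<open>f\<close> is bounded by \<open>b\<close> on \<open>V\<close>,
  then on this neighbourhood of \<open>x\<close> the function \<open>f\<close> differs from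
  \<open>f x\<close> by at most \<open>b / n\<close> for positive \<open>n\<close>. Large multiples
  thus turn bounds on \<open>V\<close> into uniform continuity estimates.\<close>

lemma openin_multiple_difference:
  assumes "openin T V" "x \<in> topspace X"
  shows "openin X {y \<in> topspace X. (i y \<otimes> inv (i x)) [^] (n :: nat) \<in> V}"
proof -
  have c: "continuous_map X T (\<lambda>y. i y \<otimes> inv (i x))"
    using assms by (intro continuous_mult continuous_i) (simp add: topspace_eq)
  have "continuous_map X T (\<lambda>y. (i y \<otimes> inv (i x)) [^] n)"
  proof (induction n)
    case 0
    show ?case by (simp add: topspace_eq)
  next
    case (Suc n)
    then show ?case using continuous_mult[OF Suc c] by simp
  qed
  then show ?thesis
    using assms(1) openin_continuous_map_preimage by blast
qed

lemma real_extension_multiple_difference: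
  assumes "continuous_map X euclidean f" "x \<in> topspace X" "y \<in> topspace X"
  shows "real_extension f ((i y \<otimes> inv (i x)) [^] (n :: nat)) = real n * (f y - f x)"
  using assms by (simp add: real_extension_pow real_extension_mult real_extension_inv real_extension)

end

section \<open>Nondiscrete k-omega spaces\<close>

locale free_abelian_k_omega = free_abelian_top_group X A T i
  for X :: "'a topology" and A :: "'g monoid" (structure) and T :: "'g topology" and i :: "'a \<Rightarrow> 'g" +
  fixes K :: "nat \<Rightarrow> 'a set"
  assumes tychonoff: "tychonoff_space X"
    and nondiscrete: "X \<noteq> discrete_topology (topspace X)"
    and compact: "\<And>n. compactin X (K n)"
    and compact_subset: "\<And>C. compactin X C \<Longrightarrow> \<exists>n. C \<subseteq> K n"
    and openinI: "\<And>U. U \<subseteq> topspace X \<Longrightarrow> (\<And>n. openin (subtopology X (K n)) (U \<inter> K n)) \<Longrightarrow> openin X U"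
begin

lemma Hausdorff: "Hausdorff_space X"
  using tychonoff by (simp add: tychonoff_space_def)

lemma K_subset: "K n \<subseteq> topspace X"
  using compact by (rule compactin_subset_topspace)

lemma separating_function:
  assumes "openin X U" "x \<in> U"
  shows "\<exists>f :: 'a \<Rightarrow> real. continuous_map X euclidean f \<and> (\<forall>y\<in>topspace X. f y \<in> {0..1}) \<and>
    f x = 0 \<and> (\<forall>y\<in>topspace X - U. f y = 1)"
proof -
  have "closedin X (topspace X - U)" "x \<in> topspace X - (topspace X - U)"
    using assms openin_subset by auto
  moreover have "completely_regular_space X"
    using tychonoff by (simp add: tychonoff_space_def)
  ultimately obtain f :: "'a \<Rightarrow> real" where f: "continuous_map X (top_of_set {0..1}) f" "f x = 0"
    "f ` (topspace X - U) \<subseteq> {1}"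
    unfolding completely_regular_space_def by meson
  then have "continuous_map X euclidean f" "f ` topspace X \<subseteq> {0..1}"
    by (auto simp: continuous_map_in_subtopology)
  then show ?thesis
    using f(2,3) by (intro exI[of _ f]) auto
qed

text \<open>Finite Hausdorff spaces are discrete, so if all \<open>K n\<close> were finite, every
  subset of \<open>X\<close> would pass the test for openness.\<close>

lemma infinite_compact: "\<exists>n. infinite (K n)"
proof (rule ccontr)
  assume "\<nexists>n. infinite (K n)"
  then have fin: "finite (K n)" for n by blast
  have "openin X U" if U: "U \<subseteq> topspace X" for U
  proof (rule openinI[OF U])
    fix n
    have "subtopology X (K n) = discrete_topology (K n)"
      using finite_t1_space_imp_discrete_topology[of "subtopology X (K n)" "K n"] fin K_subset[of n]
        Hausdorff_imp_t1_space[OF Hausdorff_space_subtopology[OF Hausdorff]]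
      by (simp add: Int_absorb1)
    then show "openin (subtopology X (K n)) (U \<inter> K n)" by simp
  qed
  then have "discrete_topology (topspace X) = X"
    by (simp add: discrete_topology_unique)
  then show False
    using nondiscrete by simp
qed

text \<open>Let points \<open>x k\<close> cluster at \<open>z\<close>. A neighbourhood
  \<open>V\<close> contains the multiple \<open>Suc n\<close> of the difference of
  \<open>x k\<close> and \<open>z\<close> for some \<open>k\<close>. As the extension of
  \<open>f k\<close> takes the value \<open>Suc n\<close> there, bounding these extensions by slowly
  growing constants forces \<open>k\<close> to be large.\<close>

lemma dominating_number_le:
  assumes B: "local_base T \<one> \<B>"
  shows "dominating_number \<le>o |\<B>|"
proof -
  obtain n where "infinite (K n)" using infinite_compact by blast
  then obtain C where C: "C \<subseteq> K n" "countable C" "infinite C"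
    using infinite_countable_subset' by blast
  then obtain z where z: "z \<in> X derived_set_of C"
    using compactin_imp_Bolzano_Weierstrass[OF compact] by blast
  then have zX: "z \<in> topspace X"
    by (simp add: in_derived_set_of)
  \<comment> \<open>The point \<open>z\<close> may belong to \<open>C\<close>; it is removed so that
    a function can separate each \<open>x k\<close> from it.\<close>
  define x where "x = from_nat_into (C - {z})"
  have range_x: "range x = C - {z}"
    unfolding x_def using C infinite_remove[OF C(3), of z]
    by (intro range_from_nat_into infinite_imp_nonempty) auto
  then have xX: "x k \<in> topspace X" and xz: "x k \<noteq> z" for k
    using C(1) K_subset by blast+
  have "\<exists>f :: 'a \<Rightarrow> real. continuous_map X euclidean f \<and> (\<forall>y\<in>topspace X. f y \<in> {0..1}) \<and>
      f z = 0 \<and> f (x k) = 1" for k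
  proof -
    have "openin X (topspace X - {x k})" "z \<in> topspace X - {x k}"
      using closedin_Hausdorff_singleton[OF Hausdorff xX] zX xz by auto
    from separating_function[OF this] obtain h :: "'a \<Rightarrow> real" where
      "continuous_map X euclidean h" "\<forall>y\<in>topspace X. h y \<in> {0..1}" "h z = 0"
      "\<forall>y\<in>topspace X - (topspace X - {x k}). h y = 1"
      by blast
    then show ?thesis
      using xX[of k] by (intro exI[of _ h]) simp
  qed
  then obtain f :: "nat \<Rightarrow> 'a \<Rightarrow> real" where f: "\<And>k. continuous_map X euclidean (f k)"
    "\<And>k y. y \<in> topspace X \<Longrightarrow> f k y \<in> {0..1}" "\<And>k. f k z = 0" "\<And>k. f k (x k) = 1"
    by metis
  have "\<exists>k. (i (x k) \<otimes> inv (i z)) [^] Suc n \<in> V" if "V \<in> \<B>" for V and n :: nat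
  proof -
    have V: "openin T V" "\<one> \<in> V" using B that by (auto simp: local_base_def)
    define U where "U = {y \<in> topspace X. (i y \<otimes> inv (i z)) [^] Suc n \<in> V}"
    have "openin X U"
      unfolding U_def by (rule openin_multiple_difference[OF V(1) zX])
    moreover have "z \<in> U"
      unfolding U_def using zX V(2) by simp
    ultimately obtain y where y: "y \<noteq> z" "y \<in> C" "y \<in> U"
      using z unfolding in_derived_set_of by blast
    then have "y \<in> range x" unfolding range_x by blast
    then show ?thesis using y(3) unfolding U_def by blast
  qed
  note * = this
  define G where "G = (\<lambda>V n. SOME k. (i (x k) \<otimes> inv (i z)) [^] Suc n \<in> V)"
  have G: "(i (x (G V n)) \<otimes> inv (i z)) [^] Suc n \<in> V" if "V \<in> \<B>" for V and n :: nat
    unfolding G_def using someI_ex[OF *[OF that]] .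
  have dom: "\<exists>q\<in>G ` \<B>. p \<le> q" for p
  proof -
    \<comment> \<open>A majorant of \<open>p\<close> that is monotone, so that \<open>L\<close>
      below tends to infinity, and exceeds the identity, so that \<open>L\<close> is defined
      everywhere.\<close>
    define g where "g = (\<lambda>n. Suc n + (\<Sum>j\<le>n. p j))"
    have g: "mono g" "n < g n" "p n \<le> g n" for n
      using member_le_sum[of n "{..n}" p] by (auto simp: g_def mono_iff_le_Suc)
    \<comment> \<open>A slowly growing inverse of \<open>g\<close>: if \<open>L k\<close> exceeds
      \<open>n\<close>, then \<open>k\<close> is at least \<open>g n\<close>.\<close>
    define L where "L = (\<lambda>k. LEAST n. k < g n)"
    have L: "k < g n \<Longrightarrow> L k \<le> n" "k < g (L k)" for k n
      unfolding L_def using LeastI[of "\<lambda>n. k < g n" k, OF g(2)] by (auto intro: Least_le)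
    \<comment> \<open>The summand \<open>1 / 2\<close> keeps the bound positive where
      \<open>L k = 0\<close>; being less than 1, it still lets
      \<open>Suc n \<le> 1 / 2 + L k\<close> imply \<open>n < L k\<close>.\<close>
    have "filterlim (\<lambda>k. 1 / 2 + real (L k)) at_top sequentially"
      unfolding filterlim_at_top eventually_sequentially
    proof
      fix Z :: real
      have "Z \<le> 1 / 2 + real (L k)" if "k \<ge> g (nat \<lceil>Z\<rceil>)" for k
      proof -
        have "\<not> L k \<le> nat \<lceil>Z\<rceil>"
          using monoD[OF g(1), of "L k" "nat \<lceil>Z\<rceil>"] L(2)[of k] that by linarith
        then show ?thesis by linarith
      qed
      then show "\<exists>N. \<forall>k\<ge>N. Z \<le> 1 / 2 + real (L k)" by blast
    qed
    then have "\<exists>V'. openin T V' \<and> \<one> \<in> V' \<and> (\<forall>a\<in>V'. \<forall>k. \<bar>real_extension (f k) a\<bar> \<le> 1 / 2 + real (L k))"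
      by (intro bounded_neighbourhood f) (auto intro: add_pos_nonneg)
    then obtain V' where V': "openin T V'" "\<one> \<in> V'"
      "\<And>k a. a \<in> V' \<Longrightarrow> \<bar>real_extension (f k) a\<bar> \<le> 1 / 2 + real (L k)"
      by blast
    then obtain V where V: "V \<in> \<B>" "V \<subseteq> V'"
      using B unfolding local_base_def by blast
    have "p n \<le> G V n" for n
    proof -
      let ?k = "G V n"
      have "\<bar>real_extension (f ?k) ((i (x ?k) \<otimes> inv (i z)) [^] Suc n)\<bar> \<le> 1 / 2 + real (L ?k)"
        using G[OF V(1), of n] V(2) by (intro V'(3)) blast
      then have "real (Suc n) \<le> 1 / 2 + real (L ?k)"
        by (simp only: real_extension_multiple_difference[OF f(1) zX xX] f) simp
      then have "\<not> L ?k \<le> n" by linarith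
      then have "\<not> ?k < g n" using L(1) by blast
      then show ?thesis using g(3)[of n] by linarith
    qed
    then show ?thesis using V(1) by (auto simp: le_fun_def)
  qed
  have "dominating_number \<le>o |G ` \<B>|"
    unfolding dominating_number_def cof_def by (rule min_card_le) (use dom in auto)
  then show ?thesis
    using card_of_image ordLeq_transitive by blast
qed

end

section \<open>The cofinality of the countable subsets as a lower bound\<close>

lemma weight_le: "base_of Y \<B> \<Longrightarrow> weight Y \<le>o |\<B>|"
  unfolding weight_def by (rule min_card_le)

lemma base_of_openin: "base_of Y {U. openin Y U}"
  unfolding base_of_def by blast

text \<open>In a Hausdorff space a point is determined by the basic sets containing it, so a finite
  base leaves room for finitely many points only.\<close>

lemma infinite_base_of:
  assumes "base_of Y \<B>" "Hausdorff_space Y" "infinite (topspace Y)"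
  shows "infinite \<B>"
proof
  assume fin: "finite \<B>"
  let ?m = "\<lambda>x. {V \<in> \<B>. x \<in> V}"
  have "inj_on ?m (topspace Y)"
  proof (rule inj_onI, rule ccontr)
    fix x y assume xy: "x \<in> topspace Y" "y \<in> topspace Y" "?m x = ?m y" "x \<noteq> y"
    obtain U where "openin Y U" "x \<in> U" "y \<notin> U"
      using assms(2) xy(1,2,4) unfolding Hausdorff_space_def disjnt_iff by metis
    then obtain V where "V \<in> \<B>" "x \<in> V" "V \<subseteq> U"
      using assms(1) unfolding base_of_def by blast
    then show False using \<open>?m x = ?m y\<close> \<open>y \<notin> U\<close> by blast
  qed
  moreover have "finite (?m ` topspace Y)"
    by (rule finite_subset[of _ "Pow \<B>"]) (use fin in auto)
  ultimately show False
    using assms(3) finite_imageD by blast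
qed

context free_abelian_k_omega
begin

lemma Card_order_weights: "r \<in> {weight (subtopology X C) | C. compactin X C} \<Longrightarrow> Card_order r"
  by (auto simp: weight_def min_card_Card_order)

lemma Card_order_compact_weight: "Card_order (compact_weight X)"
  unfolding compact_weight_def by (rule card_Sup(1)) (fact Card_order_weights)

lemma weight_le_compact_weight:
  assumes "compactin X C"
  shows "weight (subtopology X C) \<le>o |Field (compact_weight X)|"
proof -
  have "weight (subtopology X C) \<le>o compact_weight X"
    unfolding compact_weight_def
    by (rule card_Sup(2)) (use Card_order_weights assms in auto)
  then show ?thesis
    using card_of_Field_ordIso[OF Card_order_compact_weight] ordIso_symmetric ordLeq_ordIso_trans by blast
qed

lemma small_base:
  assumes "compactin X C"
  obtains \<B> where "base_of (subtopology X C) \<B>" "|\<B>| \<le>o |Field (compact_weight X)|"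
proof -
  obtain \<B> where "base_of (subtopology X C) \<B>" "weight (subtopology X C) = |\<B>|"
    using min_card[of "base_of (subtopology X C)", OF base_of_openin] unfolding weight_def by metis
  then show ?thesis
    using that weight_le_compact_weight[OF assms] by metis
qed

lemma infinite_compact_weight: "infinite (Field (compact_weight X))"
proof -
  obtain n where n: "infinite (K n)" using infinite_compact by blast
  obtain \<B> where B: "base_of (subtopology X (K n)) \<B>" "|\<B>| \<le>o |Field (compact_weight X)|"
    using small_base[OF compact] by metis
  have "infinite \<B>"
    using infinite_base_of[OF B(1) Hausdorff_space_subtopology[OF Hausdorff]] n K_subset[of n]
    by (simp add: Int_absorb1)
  then show ?thesis using B(2) card_of_ordLeq_infinite by blast
qed

section \<open>Uniformly separated families of functions\<close>

definition unit_functions :: "('a \<Rightarrow> real) set" where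
  "unit_functions = {f. continuous_map X euclidean f \<and> (\<forall>x\<in>topspace X. f x \<in> {0..1})}"

text \<open>The distance \<open>1 / 3\<close> is less than one half, so a function this close to one
  with values 0 and 1 still tells these values apart at the threshold \<open>1 / 2\<close>.\<close>

definition separated_on :: "'a set \<Rightarrow> ('a \<Rightarrow> real) set \<Rightarrow> bool" where
  "separated_on C D \<longleftrightarrow> D \<subseteq> unit_functions \<and> (\<forall>f\<in>D. \<forall>g\<in>D. f \<noteq> g \<longrightarrow> (\<exists>x\<in>C. 1 / 3 \<le> \<bar>f x - g x\<bar>))"

text \<open>By Zorn's lemma there is a maximal separated family; a function not close on all of
  \<open>C\<close> to any single member could be added to it.\<close>

lemma maximal_separated:
  obtains D where "separated_on C D"
    "\<And>\<phi>. \<phi> \<in> unit_functions \<Longrightarrow> \<exists>f\<in>D. \<forall>x\<in>C. \<bar>f x - \<phi> x\<bar> < 1 / 3"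
proof -
  have "\<exists>D\<in>Collect (separated_on C). \<forall>E\<in>Collect (separated_on C). D \<subseteq> E \<longrightarrow> E = D"
  proof (rule subset_Zorn')
    fix \<C> assume "subset.chain (Collect (separated_on C)) \<C>"
    then have *: "\<C> \<subseteq> Collect (separated_on C)" "\<forall>D\<in>\<C>. \<forall>E\<in>\<C>. D \<subseteq> E \<or> E \<subseteq> D"
      unfolding subset_chain_def by simp_all
    then have sep: "separated_on C D" if "D \<in> \<C>" for D
      using that by blast
    have "\<exists>x\<in>C. 1 / 3 \<le> \<bar>f x - g x\<bar>" if fg: "f \<in> \<Union>\<C>" "g \<in> \<Union>\<C>" "f \<noteq> g" for f g
    proof -
      obtain D where "D \<in> \<C>" "f \<in> D" "g \<in> D"
        using fg(1,2) *(2) by (meson UnionE subsetD)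
      then show ?thesis
        using sep fg(3) unfolding separated_on_def by blast
    qed
    moreover have "\<Union>\<C> \<subseteq> unit_functions"
      using sep unfolding separated_on_def by blast
    ultimately show "\<Union>\<C> \<in> Collect (separated_on C)"
      unfolding separated_on_def by blast
  qed
  then obtain D where D: "separated_on C D"
    and max: "\<And>E. separated_on C E \<Longrightarrow> D \<subseteq> E \<Longrightarrow> E = D"
    by blast
  have "\<exists>f\<in>D. \<forall>x\<in>C. \<bar>f x - \<phi> x\<bar> < 1 / 3" if \<phi>: "\<phi> \<in> unit_functions" for \<phi>
  proof (rule ccontr)
    assume "\<not> ?thesis"
    then have far: "\<forall>f\<in>D. \<exists>x\<in>C. 1 / 3 \<le> \<bar>f x - \<phi> x\<bar>"
      by (simp add: not_less)
    then have "\<forall>f\<in>D. \<exists>x\<in>C. 1 / 3 \<le> \<bar>\<phi> x - f x\<bar>"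
      by (simp add: abs_minus_commute)
    with far have "separated_on C (insert \<phi> D)"
      using D \<phi> unfolding separated_on_def by blast
    then have "\<phi> \<in> D"
      using max by blast
    then show False using far by fastforce
  qed
  then show ?thesis using that D by blast
qed

text \<open>The sets where some \<open>f\<close> in \<open>D\<close> is below \<open>1 / 2\<close>
  form a base of \<open>C\<close>: approximate a function that vanishes at the given point and is 1
  outside the given open set.\<close>

lemma weight_le_separated:
  assumes D: "D \<subseteq> unit_functions"
    "\<And>\<phi>. \<phi> \<in> unit_functions \<Longrightarrow> \<exists>f\<in>D. \<forall>x\<in>C. \<bar>f x - \<phi> x\<bar> < 1 / 3"
  shows "weight (subtopology X C) \<le>o |D|"
proof -
  define b where "b = (\<lambda>f :: 'a \<Rightarrow> real. {x \<in> topspace X. f x \<in> {..<1 / 2}} \<inter> C)"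
  have "base_of (subtopology X C) (b ` D)"
    unfolding base_of_def
  proof (intro conjI ballI allI impI)
    fix V assume "V \<in> b ` D"
    then obtain f where f: "f \<in> D" "V = b f" by blast
    then have "openin X {x \<in> topspace X. f x \<in> {..<1 / 2}}"
      using D(1) unfolding unit_functions_def
      by (intro openin_continuous_map_preimage[where Y = euclidean]) auto
    then show "openin (subtopology X C) V"
      unfolding f(2) b_def openin_subtopology by blast
  next
    fix U x assume "openin (subtopology X C) U \<and> x \<in> U"
    then obtain U' where U: "openin X U'" "U = U' \<inter> C" "x \<in> U'" "x \<in> C"
      unfolding openin_subtopology by blast
    obtain \<phi> :: "'a \<Rightarrow> real" where \<phi>: "continuous_map X euclidean \<phi>" "\<forall>y\<in>topspace X. \<phi> y \<in> {0..1}"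
      "\<phi> x = 0" "\<forall>y\<in>topspace X - U'. \<phi> y = 1"
      using separating_function[OF U(1,3)] by blast
    then obtain f where f: "f \<in> D" "\<forall>x\<in>C. \<bar>f x - \<phi> x\<bar> < 1 / 3"
      using D(2)[of \<phi>] unfolding unit_functions_def by blast
    have "x \<in> b f"
      using f(2) U \<phi>(3) openin_subset[OF U(1)] by (fastforce simp: b_def)
    moreover have "b f \<subseteq> U"
    proof
      fix y assume y: "y \<in> b f"
      then have "y \<in> C" "y \<in> topspace X" "f y < 1 / 2" by (auto simp: b_def)
      moreover have "\<bar>f y - \<phi> y\<bar> < 1 / 3" using f(2) \<open>y \<in> C\<close> by blast
      ultimately have "\<phi> y \<noteq> 1" by linarith
      then show "y \<in> U"
        using \<phi>(4) U(2) \<open>y \<in> C\<close> \<open>y \<in> topspace X\<close> by blast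
    qed
    ultimately show "\<exists>V\<in>b ` D. x \<in> V \<and> V \<subseteq> U" using f(1) by blast
  qed
  then have "weight (subtopology X C) \<le>o |b ` D|" by (rule weight_le)
  then show ?thesis
    using card_of_image ordLeq_transitive by blast
qed

text \<open>The functions with a common bound \<open>b\<close> on \<open>V\<close> form an equicontinuous, hence totally bounded,
  set on the compact set \<open>K j\<close>.\<close>

lemma countable_bounded_separated:
  assumes V: "openin T V" "\<one> \<in> V" and D: "separated_on (K j) D"
  shows "countable {f \<in> D. \<exists>b :: nat. \<forall>a\<in>V. \<bar>real_extension f a\<bar> \<le> real b}"
proof -
  have "finite {f \<in> D. \<forall>a\<in>V. \<bar>real_extension f a\<bar> \<le> real b}" (is "finite ?F") for b :: nat
  proof -
    \<comment> \<open>With this multiple, functions bounded by \<open>b\<close> vary by at most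
      \<open>1 / 12\<close> on each \<open>U x\<close>. Two such variations and a rounding error of
      \<open>1 / 12\<close> stay below the separation \<open>1 / 3\<close>.\<close>
    define N where "N = 12 * Suc b"
    define U where "U = (\<lambda>x. {y \<in> topspace X. (i y \<otimes> inv (i x)) [^] N \<in> V})"
    have close: "\<bar>f y - f x\<bar> \<le> 1 / 12" if "f \<in> ?F" "x \<in> topspace X" "y \<in> U x" for f x y
    proof -
      have "continuous_map X euclidean f"
        using that(1) D unfolding separated_on_def unit_functions_def by blast
      then have "real_extension f ((i y \<otimes> inv (i x)) [^] N) = real N * (f y - f x)"
        using that by (intro real_extension_multiple_difference) (auto simp: U_def)
      moreover have "\<bar>real_extension f ((i y \<otimes> inv (i x)) [^] N)\<bar> \<le> real b"
        using that by (auto simp: U_def)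
      ultimately have "real N * \<bar>f y - f x\<bar> \<le> real b"
        by (simp add: abs_mult)
      also have "real b \<le> real N * (1 / 12)"
        by (simp add: N_def)
      finally show ?thesis
        by (rule mult_left_le_imp_le) (simp add: N_def)
    qed
    have "openin X (U x)" "x \<in> U x" if "x \<in> K j" for x
    proof -
      have "x \<in> topspace X" using that K_subset by blast
      then show "openin X (U x)" "x \<in> U x"
        using openin_multiple_difference[OF V(1)] V(2) by (simp_all add: U_def)
    qed
    then have "Ball (U ` K j) (openin X)" "K j \<subseteq> \<Union>(U ` K j)"
      by auto
    then obtain \<F> where \<F>: "finite \<F>" "\<F> \<subseteq> U ` K j" "K j \<subseteq> \<Union>\<F>"
      using compact[of j] unfolding compactin_def by meson
    from finite_subset_image[OF \<F>(1,2)] obtain P where P: "P \<subseteq> K j" "finite P" "\<F> = U ` P"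
      by blast
    have K_cover: "K j \<subseteq> (\<Union>x\<in>P. U x)"
      using \<F>(3) unfolding P(3) .
    \<comment> \<open>Rounding the values on the finite set \<open>P\<close> leaves finitely many
      signatures, and by the choice of \<open>N\<close> a signature determines the function within
      \<open>?F\<close>.\<close>
    define s where "s = (\<lambda>f :: 'a \<Rightarrow> real. restrict (\<lambda>x. \<lfloor>12 * f x\<rfloor>) P)"
    have "s ` ?F \<subseteq> P \<rightarrow>\<^sub>E {0..12}"
    proof (rule image_subsetI)
      fix f assume "f \<in> ?F"
      then have "f \<in> unit_functions"
        using D unfolding separated_on_def by blast
      then have "f x \<in> {0..1}" if "x \<in> P" for x
        using that P(1) K_subset[of j] unfolding unit_functions_def by blast
      then have "\<lfloor>12 * f x\<rfloor> \<in> {0..12}" if "x \<in> P" for x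
        using that by (fastforce simp: floor_le_iff)
      then show "s f \<in> P \<rightarrow>\<^sub>E {0..12}"
        unfolding s_def by (simp add: restrict_PiE_iff)
    qed
    then have "finite (s ` ?F)"
      by (rule finite_subset) (intro finite_PiE P(2) finite_atLeastAtMost_int)
    moreover have "inj_on s ?F"
    proof (rule inj_onI, rule ccontr)
      fix f g assume fg: "f \<in> ?F" "g \<in> ?F" "s f = s g" "f \<noteq> g"
      then obtain y where y: "y \<in> K j" "1 / 3 \<le> \<bar>f y - g y\<bar>"
        using D unfolding separated_on_def by blast
      then obtain x where x: "x \<in> P" "y \<in> U x" using K_cover by blast
      then have xX: "x \<in> topspace X" using P(1) K_subset by blast
      have "\<lfloor>12 * f x\<rfloor> = \<lfloor>12 * g x\<rfloor>"
        using fun_cong[OF fg(3), of x] x(1) by (simp add: s_def)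
      then have "\<bar>12 * f x - 12 * g x\<bar> < 1" by linarith
      moreover have "\<bar>f y - f x\<bar> \<le> 1 / 12" "\<bar>g y - g x\<bar> \<le> 1 / 12"
        using close xX x(2) fg(1,2) by blast+
      ultimately show False using y(2) by linarith
    qed
    ultimately show ?thesis by (rule finite_imageD)
  qed
  then have "countable (\<Union>b. {f \<in> D. \<forall>a\<in>V. \<bar>real_extension f a\<bar> \<le> real b})"
    by (intro countable_UN) (auto intro: countable_finite)
  then show ?thesis
    by (rule countable_subset[rotated]) blast
qed

text \<open>The compact weight is embedded into separated functions. To \<open>V\<close> belongs the
  set \<open>c V\<close> of indices whose functions have bounded extensions on \<open>V\<close>. It
  is countable, and every countable set is covered by some \<open>c V\<close> because countably many
  functions can be bounded simultaneously.\<close>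

lemma cof_countable_le:
  assumes B: "local_base T \<one> \<B>"
  shows "cof (countably_infinite_subsets (Field (compact_weight X))) \<le>o |\<B>|"
proof -
  let ?F = "Field (compact_weight X)"
  have "\<exists>D. separated_on (K j) D \<and>
      (\<forall>\<phi>\<in>unit_functions. \<exists>f\<in>D. \<forall>x\<in>K j. \<bar>f x - \<phi> x\<bar> < 1 / 3)" for j
    by (rule maximal_separated[of "K j"]) blast
  then obtain D where D: "\<And>j. separated_on (K j) (D j)"
    "\<And>j \<phi>. \<phi> \<in> unit_functions \<Longrightarrow> \<exists>f\<in>D j. \<forall>x\<in>K j. \<bar>f x - \<phi> x\<bar> < 1 / 3"
    by metis
  define D' where "D' = (\<Union>j. D j)"
  have D'_unit: "D' \<subseteq> unit_functions"
    using D(1) unfolding D'_def separated_on_def by blast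
  \<comment> \<open>Every compact set lies in some \<open>K j\<close>, on which \<open>D j\<close>
    approximates all unit functions. Hence the cardinality of \<open>D'\<close> is an upper bound of
    all the weights.\<close>
  have "compact_weight X \<le>o |D'|"
    unfolding compact_weight_def
  proof (rule card_Sup(3))
    fix r assume "r \<in> {weight (subtopology X C) | C. compactin X C}"
    then obtain C j where r: "r = weight (subtopology X C)" "C \<subseteq> K j"
      using compact_subset by blast
    show "r \<le>o |D'|"
      unfolding r(1)
    proof (rule weight_le_separated[OF D'_unit])
      fix \<phi> assume "\<phi> \<in> unit_functions"
      then show "\<exists>f\<in>D'. \<forall>x\<in>C. \<bar>f x - \<phi> x\<bar> < 1 / 3"
        using D(2)[of \<phi> j] r(2) unfolding D'_def by blast
    qed
  qed (auto intro: Card_order_weights card_of_Card_order)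
  then have "|?F| \<le>o |D'|"
    using card_of_Field_ordIso[OF Card_order_compact_weight] ordIso_ordLeq_trans by blast
  then obtain e where e: "inj_on e ?F" "e ` ?F \<subseteq> D'"
    unfolding card_of_ordLeq[symmetric] by blast
  \<comment> \<open>Padding by \<open>E\<close> makes every \<open>c V\<close> infinite.\<close>
  obtain E where E: "E \<subseteq> ?F" "countable E" "infinite E"
    using infinite_countable_subset'[OF infinite_compact_weight] by blast
  define S where "S = (\<lambda>V. {f \<in> D'. \<exists>b :: nat. \<forall>a\<in>V. \<bar>real_extension f a\<bar> \<le> real b})"
  define c where "c = (\<lambda>V. {s \<in> ?F. e s \<in> S V} \<union> E)"
  have "c V \<in> countably_infinite_subsets ?F" if "V \<in> \<B>" for V
  proof -
    have "openin T V" "\<one> \<in> V" using B that by (auto simp: local_base_def)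
    then have "countable (\<Union>j. {f \<in> D j. \<exists>b :: nat. \<forall>a\<in>V. \<bar>real_extension f a\<bar> \<le> real b})"
      using countable_bounded_separated D(1) by (intro countable_UN) auto
    then have "countable (S V)"
      by (rule countable_subset[rotated]) (auto simp: S_def D'_def)
    then have "countable {s \<in> ?F. e s \<in> S V}"
      using e(1) by (intro countable_image_inj_on[of e]) (auto intro: countable_subset inj_on_subset)
    then show ?thesis
      using E by (auto simp: countably_infinite_subsets_def c_def)
  qed
  moreover have "\<exists>V\<in>\<B>. C \<subseteq> c V" if C: "C \<in> countably_infinite_subsets ?F" for C
  proof -
    have C': "C \<subseteq> ?F" "countable C" "infinite C"
      using C by (auto simp: countably_infinite_subsets_def)
    define f where "f = (\<lambda>k. e (from_nat_into C k))"
    have "range f = e ` range (from_nat_into C)"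
      by (simp add: f_def image_image)
    then have rf: "range f = e ` C"
      by (simp add: range_from_nat_into[OF infinite_imp_nonempty[OF C'(3)] C'(2)])
    then have f: "f k \<in> D'" for k
      using e(2) C'(1) by blast
    have "f k \<in> unit_functions" for k
      using f D'_unit by blast
    then have "continuous_map X euclidean (f k)" "x \<in> topspace X \<Longrightarrow> f k x \<in> {0..1}" for k x
      by (auto simp: unit_functions_def)
    moreover have "filterlim (\<lambda>k. real (Suc k)) at_top sequentially"
      using filterlim_compose[OF filterlim_real_sequentially filterlim_Suc] .
    ultimately have "\<exists>V'. openin T V' \<and> \<one> \<in> V' \<and> (\<forall>a\<in>V'. \<forall>k. \<bar>real_extension (f k) a\<bar> \<le> real (Suc k))"
      by (intro bounded_neighbourhood) auto
    then obtain V' where V': "openin T V'" "\<one> \<in> V'"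
      "\<And>k a. a \<in> V' \<Longrightarrow> \<bar>real_extension (f k) a\<bar> \<le> real (Suc k)"
      by blast
    then obtain V where V: "V \<in> \<B>" "V \<subseteq> V'"
      using B unfolding local_base_def by blast
    have "s \<in> c V" if "s \<in> C" for s
    proof -
      have "e s \<in> range f"
        unfolding rf using that by (rule imageI)
      then obtain k where k: "e s = f k" by auto
      have "\<forall>a\<in>V. \<bar>real_extension (f k) a\<bar> \<le> real (Suc k)"
        using V'(3) V(2) by blast
      with f[of k] have "e s \<in> S V"
        unfolding S_def k by (intro CollectI conjI exI[of _ "Suc k"])
      then show ?thesis using that C'(1) by (auto simp: c_def)
    qed
    then show ?thesis using V(1) by blast
  qed
  ultimately have "cof (countably_infinite_subsets ?F) \<le>o |c ` \<B>|"
    unfolding cof_def by (intro min_card_le) blast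
  then show ?thesis
    using card_of_image ordLeq_transitive by blast
qed

end

section \<open>A small local base\<close>

lemma min_card_attained:
  assumes "P B0"
  shows "\<exists>B. P B \<and> min_card P = |B|"
proof (rule min_card[of P, OF assms])
  fix B assume "P B" "min_card P = |B|"
  then show ?thesis by (intro exI[of _ B] conjI)
qed

lemma cof_attained: "\<exists>C. C \<subseteq> P \<and> (\<forall>p\<in>P. \<exists>c\<in>C. p \<le> c) \<and> cof P = |C|"
proof -
  have "P \<subseteq> P \<and> (\<forall>p\<in>P. \<exists>c\<in>P. p \<le> c)"
    by blast
  from min_card_attained[of "\<lambda>C. C \<subseteq> P \<and> (\<forall>p\<in>P. \<exists>c\<in>C. p \<le> c)", OF this]
  show ?thesis
    unfolding cof_def by (simp only: conj_assoc)
qed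

lemma cmax_least:
  assumes "Card_order r" "Card_order s" "r \<le>o t" "s \<le>o t"
  shows "cmax r s \<le>o t"
proof (cases "r \<le>o s")
  case True
  then show ?thesis
    using cmax2[OF assms(1,2)] assms(4) ordIso_ordLeq_trans by blast
next
  case False
  then have "s \<le>o r"
    using assms(1,2) ordLeq_total unfolding card_order_on_def by blast
  then show ?thesis
    using cmax1[OF assms(1,2)] assms(3) ordIso_ordLeq_trans by blast
qed

text \<open>No member of a finite family dominates one plus the sum of the family.\<close>

lemma infinite_dominating:
  fixes D :: "(nat \<Rightarrow> nat) set"
  assumes "\<And>p. \<exists>q\<in>D. p \<le> q"
  shows "infinite D"
proof
  assume fin: "finite D"
  obtain q where q: "q \<in> D" "(\<lambda>n. Suc (\<Sum>q\<in>D. q n)) \<le> q"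
    using assms by blast
  have "Suc (\<Sum>q\<in>D. q 0) \<le> q 0"
    using q(2) by (simp add: le_fun_def)
  moreover have "q 0 \<le> (\<Sum>q\<in>D. q 0)"
    by (rule member_le_sum) (use fin q(1) in auto)
  ultimately show False by linarith
qed

text \<open>An infinite set has only as many finite subsets as elements. This lets the compact
  weight code the finite families of basic sets.\<close>

lemma Fpow_ordLeq:
  assumes "|B| \<le>o |F|" "infinite F"
  shows "|Fpow B| \<le>o |F|"
proof -
  obtain f where f: "inj_on f B" "f ` B \<subseteq> F"
    using assms(1) unfolding card_of_ordLeq[symmetric] by blast
  then have "(image f) ` Fpow B \<subseteq> Fpow F"
    by (intro image_Fpow_mono)
  then have "|Fpow B| \<le>o |Fpow F|"
    using inj_on_image_Fpow[OF f(1)] card_of_ordLeq by blast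
  then show ?thesis
    using card_of_Fpow_infinite[OF assms(2)] ordLeq_ordIso_trans by blast
qed

section \<open>Filtrations of open sets\<close>

context free_abelian_top_group
begin

text \<open>These are the algebraic conditions of \<open>filtration_neighbourhood\<close>. They
  contain no topology and are preserved by levelwise intersections, which need not be open.\<close>

definition filtration :: "(nat \<Rightarrow> 'g set) \<Rightarrow> bool" where
  "filtration F \<longleftrightarrow> (\<forall>m. F m \<subseteq> carrier A \<and> \<one> \<in> F m \<and> (\<forall>a\<in>F m. inv a \<in> F m) \<and>
     (\<forall>a\<in>F (Suc m). \<forall>b\<in>F (Suc m). a \<otimes> b \<in> F m))"

lemma symmetric_root:
  assumes U: "openin T U" "\<one> \<in> U"
  shows "\<exists>V. (openin T V \<and> \<one> \<in> V \<and> (\<forall>a\<in>V. inv a \<in> V)) \<and> (\<forall>a\<in>V. \<forall>b\<in>V. a \<otimes> b \<in> U)"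
proof -
  define M where "M = {p \<in> topspace (prod_topology T T). (case p of (a, b) \<Rightarrow> a \<otimes> b) \<in> U}"
  have "openin (prod_topology T T) M"
    unfolding M_def using abelian_topological_group U(1)
    by (intro openin_continuous_map_preimage) (auto simp: abelian_topological_group_def)
  moreover have "(\<one>, \<one>) \<in> M"
    using U(2) by (simp add: M_def topspace_eq)
  ultimately obtain V1 V2 where V12: "openin T V1" "openin T V2" "\<one> \<in> V1" "\<one> \<in> V2" "V1 \<times> V2 \<subseteq> M"
    unfolding openin_prod_topology_alt by meson
  define V where "V = V1 \<inter> V2 \<inter> {a \<in> topspace T. inv a \<in> V1 \<inter> V2}"
  have "openin T V"
    unfolding V_def using V12(1,2) by (intro openin_Int openin_continuous_map_preimage[OF continuous_inv])
  moreover have "\<one> \<in> V"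
    using V12 by (simp add: V_def topspace_eq)
  moreover have "inv a \<in> V" if "a \<in> V" for a
    using that by (simp add: V_def topspace_eq)
  moreover have "a \<otimes> b \<in> U" if "a \<in> V" "b \<in> V" for a b
  proof -
    have "(a, b) \<in> M" using that V12(5) unfolding V_def by blast
    then show ?thesis by (simp add: M_def)
  qed
  ultimately show ?thesis by blast
qed

text \<open>Dependent choice iterates \<open>symmetric_root\<close>. Only the first set has to be
  compared with \<open>U\<close>, which the condition on index 0 records.\<close>

lemma open_filtration:
  assumes U: "openin T U" "\<one> \<in> U"
  shows "\<exists>F. filtration F \<and> (\<forall>m. openin T (F m)) \<and> F 0 \<subseteq> U"
proof -
  let ?P = "\<lambda>V. openin T V \<and> \<one> \<in> V \<and> (\<forall>a\<in>V. inv a \<in> V)"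
  have "\<exists>F :: nat \<Rightarrow> 'g set. \<forall>m. (?P (F m) \<and> (m = 0 \<longrightarrow> F m \<subseteq> U)) \<and>
      (\<forall>a\<in>F (Suc m). \<forall>b\<in>F (Suc m). a \<otimes> b \<in> F m)"
  proof (rule dependent_nat_choice)
    obtain V where V: "?P V" "\<forall>a\<in>V. \<forall>b\<in>V. a \<otimes> b \<in> U"
      using symmetric_root[OF U] by blast
    have "a \<in> U" if "a \<in> V" for a
    proof -
      have "a \<in> carrier A" using that V(1) openin_subset topspace_eq by blast
      then have "a \<otimes> \<one> = a" by simp
      then show ?thesis using V that by metis
    qed
    then show "\<exists>V. ?P V \<and> ((0::nat) = 0 \<longrightarrow> V \<subseteq> U)"
      using V(1) by blast
  next
    fix V and m :: nat assume "?P V \<and> (m = 0 \<longrightarrow> V \<subseteq> U)"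
    then show "\<exists>V'. (?P V' \<and> (Suc m = 0 \<longrightarrow> V' \<subseteq> U)) \<and> (\<forall>a\<in>V'. \<forall>b\<in>V'. a \<otimes> b \<in> V)"
      using symmetric_root[of V] by simp
  qed
  then obtain F :: "nat \<Rightarrow> 'g set" where *: "\<forall>m. (?P (F m) \<and> (m = 0 \<longrightarrow> F m \<subseteq> U)) \<and>
      (\<forall>a\<in>F (Suc m). \<forall>b\<in>F (Suc m). a \<otimes> b \<in> F m)"
    by (rule exE)
  have F: "?P (F m)" "\<forall>a\<in>F (Suc m). \<forall>b\<in>F (Suc m). a \<otimes> b \<in> F m" for m
    using *[THEN spec, of m] by simp_all
  have F0: "F 0 \<subseteq> U"
    using *[THEN spec, of 0] by simp
  have "F m \<subseteq> carrier A" for m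
    using F(1) openin_subset topspace_eq by metis
  then have "filtration F"
    unfolding filtration_def using F by simp
  moreover have "\<forall>m. openin T (F m)"
    using F(1) by simp
  ultimately show ?thesis using F0 by (intro exI conjI)
qed

end

section \<open>Finite covers and their codes\<close>

context free_abelian_k_omega
begin

text \<open>Smallness concerns any two points of \<open>G\<close> rather than a centre, so one
  finite cover controls the differences from every \<open>x\<close> in \<open>K n\<close>.\<close>

definition fine_cover :: "nat \<Rightarrow> 'a set set \<Rightarrow> 'g set \<Rightarrow> bool" where
  "fine_cover n \<G> P \<longleftrightarrow> (\<forall>x\<in>K n. \<exists>G\<in>\<G>. x \<in> G \<and> (\<forall>y\<in>G. \<forall>z\<in>G. inv (i y) \<otimes> i z \<in> P))"

text \<open>Around \<open>x\<close> take a basic set on which the differences from \<open>x\<close>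
  lie in \<open>F (Suc m)\<close>; the difference of two of its points combines two of these and
  lies in \<open>F m\<close>. Compactness of \<open>K n\<close> selects finitely many such
  sets.\<close>

lemma finite_fine_cover:
  assumes \<B>: "base_of (subtopology X (K n)) \<B>" and F: "filtration F" "\<And>m. openin T (F m)"
  shows "\<exists>\<G>\<in>Fpow \<B>. fine_cover n \<G> (F m)"
proof -
  let ?small = "\<lambda>G. \<forall>y\<in>G. \<forall>z\<in>G. inv (i y) \<otimes> i z \<in> F m"
  have "\<exists>G\<in>\<B>. x \<in> G \<and> ?small G" if x: "x \<in> K n" for x
  proof -
    have xX: "x \<in> topspace X" using x K_subset by blast
    define O' where "O' = {y \<in> topspace X. inv (i x) \<otimes> i y \<in> F (Suc m)}"
    have "continuous_map X T (\<lambda>y. inv (i x) \<otimes> i y)"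
      using xX by (intro continuous_mult continuous_i) (simp add: topspace_eq)
    then have "openin X O'"
      unfolding O'_def using F(2) openin_continuous_map_preimage by blast
    then have "openin (subtopology X (K n)) (O' \<inter> K n)"
      unfolding openin_subtopology by blast
    moreover have "x \<in> O' \<inter> K n"
      using x xX F(1) by (simp add: O'_def filtration_def)
    ultimately obtain G where G: "G \<in> \<B>" "x \<in> G" "G \<subseteq> O' \<inter> K n"
      using \<B> unfolding base_of_def by blast
    have "inv (i y) \<otimes> i z \<in> F m" if "y \<in> G" "z \<in> G" for y z
    proof -
      have yz: "y \<in> topspace X" "inv (i x) \<otimes> i y \<in> F (Suc m)" "z \<in> topspace X" "inv (i x) \<otimes> i z \<in> F (Suc m)"
        using that G(3) by (auto simp: O'_def)
      then have "inv (inv (i x) \<otimes> i y) \<otimes> (inv (i x) \<otimes> i z) \<in> F m"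
        using F(1) by (simp add: filtration_def)
      moreover have "i x \<otimes> (inv (i x) \<otimes> i z) = i z"
        using xX yz by (simp add: m_assoc[symmetric])
      then have "inv (inv (i x) \<otimes> i y) \<otimes> (inv (i x) \<otimes> i z) = inv (i y) \<otimes> i z"
        using xX yz by (simp add: inv_mult_group m_assoc)
      ultimately show ?thesis
        by simp
    qed
    then show ?thesis using G(1,2) by blast
  qed
  then obtain G where G: "\<And>x. x \<in> K n \<Longrightarrow> G x \<in> \<B> \<and> x \<in> G x \<and> ?small (G x)"
    by metis
  have "compactin (subtopology X (K n)) (K n)"
    using compact by (simp add: compactin_subtopology)
  moreover have "Ball (G ` K n) (openin (subtopology X (K n)))" "K n \<subseteq> \<Union>(G ` K n)"
    using G \<B> unfolding base_of_def by blast+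
  ultimately obtain \<G> where \<G>: "finite \<G>" "\<G> \<subseteq> G ` K n" "K n \<subseteq> \<Union>\<G>"
    unfolding compactin_def by meson
  have "\<G> \<in> Fpow \<B>"
    using \<G> G by (auto simp: Fpow_def)
  moreover have "fine_cover n \<G> (F m)"
    unfolding fine_cover_def
  proof
    fix x assume "x \<in> K n"
    then obtain H where "H \<in> \<G>" "x \<in> H" using \<G>(3) by blast
    moreover from this obtain x' where "x' \<in> K n" "H = G x'" using \<G>(2) by blast
    ultimately show "\<exists>G\<in>\<G>. x \<in> G \<and> ?small G" using G by blast
  qed
  ultimately show ?thesis by blast
qed

text \<open>Finite families of basic open subsets of \<open>K n\<close> are coded by elements of the compact weight.
  A pair \<open>(C, g)\<close> dominates the filtrations that admit, for all \<open>n\<close> and \<open>m\<close>, a fine cover of \<open>K n\<close>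
  at level \<open>m\<close> among the first \<open>g (n, m)\<close> codes in \<open>C\<close>. Being finitely many, these covers have a common
  refinement, so the intersection of all dominated filtrations still yields a neighbourhood of the
  identity.\<close>

lemma small_local_base:
  assumes D: "\<And>p. \<exists>q\<in>\<D>. p \<le> (q :: nat \<Rightarrow> nat)"
    and C: "\<C> \<subseteq> countably_infinite_subsets (Field (compact_weight X))"
      "\<And>S. S \<in> countably_infinite_subsets (Field (compact_weight X)) \<Longrightarrow> \<exists>C\<in>\<C>. S \<subseteq> C"
  shows "\<exists>\<B>. local_base T \<one> \<B> \<and> |\<B>| \<le>o |\<C> \<times> \<D>|"
proof -
  let ?F = "Field (compact_weight X)"
  have "\<exists>\<B> c. base_of (subtopology X (K n)) \<B> \<and> c ` ?F = Fpow \<B>" for n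
  proof -
    obtain \<B> where B: "base_of (subtopology X (K n)) \<B>" "|\<B>| \<le>o |?F|"
      by (rule small_base[OF compact])
    have "|Fpow \<B>| \<le>o |?F|"
      using B(2) infinite_compact_weight by (rule Fpow_ordLeq)
    then have "\<exists>c. c ` ?F = Fpow \<B>"
      using card_of_ordLeq2[OF Fpow_not_empty] by blast
    then show ?thesis using B(1) by blast
  qed
  then obtain \<B> cov where B: "\<And>n. base_of (subtopology X (K n)) (\<B> n)"
    and cov: "\<And>n. cov n ` ?F = Fpow (\<B> n)"
    by metis
  define fits where "fits = (\<lambda>C g F. \<forall>n m. \<exists>k \<le> g (prod_encode (n, m)).
    fine_cover n (cov n (from_nat_into C k)) (F m))"
  \<comment> \<open>Restricting to \<open>carrier A\<close> keeps the intersection inside the group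
    even if no filtration fits.\<close>
  define W where "W = (\<lambda>C g m. {a \<in> carrier A. \<forall>F. filtration F \<and> fits C g F \<longrightarrow> a \<in> F m})"
  have "\<exists>V. openin T V \<and> \<one> \<in> V \<and> V \<subseteq> W C g 0" if "C \<in> \<C>" for C g
  proof -
    have CF: "from_nat_into C k \<in> ?F" for k
    proof -
      have "C \<subseteq> ?F" "infinite C"
        using that assms(2) by (auto simp: countably_infinite_subsets_def)
      then show ?thesis
        using from_nat_into[of C k] infinite_imp_nonempty by blast
    qed
    have loc: "\<exists>V. openin (subtopology X (K n)) V \<and> x \<in> V \<and> (\<forall>y\<in>V. inv (i x) \<otimes> i y \<in> W C g m)"
      if x: "x \<in> K n" for n x m
    proof -
      \<comment> \<open>All basic sets around \<open>x\<close> in the first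
        \<open>g (prod_encode (n, m))\<close> families and the one after them: finitely many, and
        among them a small one for each \<open>F\<close> that fits.\<close>
      define \<G> where "\<G> = {G \<in> (\<Union>k\<le>g (prod_encode (n, m)). cov n (from_nat_into C k)). x \<in> G}"
      have cov': "cov n (from_nat_into C k) \<in> Fpow (\<B> n)" for k
        using cov CF by blast
      then have "finite \<G>"
        by (auto simp: \<G>_def Fpow_def)
      moreover have "openin (subtopology X (K n)) G" if "G \<in> \<G>" for G
        using that cov' B[of n] unfolding \<G>_def Fpow_def base_of_def by blast
      ultimately have "openin (subtopology X (K n)) (topspace (subtopology X (K n)) \<inter> \<Inter>\<G>)"
        by (intro openin_Int_Inter[OF _ openin_topspace])
      moreover have "x \<in> topspace (subtopology X (K n)) \<inter> \<Inter>\<G>"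
        using x K_subset by (auto simp: \<G>_def)
      moreover have "inv (i x) \<otimes> i y \<in> W C g m" if y: "y \<in> topspace (subtopology X (K n)) \<inter> \<Inter>\<G>" for y
      proof -
        have "inv (i x) \<otimes> i y \<in> F m" if F: "fits C g F" for F
        proof -
          obtain k where k: "k \<le> g (prod_encode (n, m))" "fine_cover n (cov n (from_nat_into C k)) (F m)"
            using F unfolding fits_def by blast
          then obtain G where G: "G \<in> cov n (from_nat_into C k)" "x \<in> G"
            "\<forall>y\<in>G. \<forall>z\<in>G. inv (i y) \<otimes> i z \<in> F m"
            using x unfolding fine_cover_def by blast
          have "G \<in> \<G>" using G(1,2) k(1) by (auto simp: \<G>_def)
          then have "y \<in> G" using y by blast
          then show ?thesis using G(2,3) by blast
        qed
        moreover have "x \<in> topspace X" "y \<in> topspace X"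
          using x K_subset y by auto
        ultimately show ?thesis by (simp add: W_def)
      qed
      ultimately show ?thesis by blast
    qed
    show ?thesis
    proof (rule filtration_neighbourhood[where W = "W C g" and \<K> = "range K"])
      show "openin X U" if "U \<subseteq> topspace X" "\<And>L. L \<in> range K \<Longrightarrow> openin (subtopology X L) (U \<inter> L)" for U
        using that by (intro openinI) auto
      show "\<exists>V. openin (subtopology X L) V \<and> x \<in> V \<and> (\<forall>y\<in>V. inv (i x) \<otimes> i y \<in> W C g m)"
        if "L \<in> range K" "x \<in> L" for L x m
        using that loc by auto
      show "W C g m \<subseteq> carrier A" "\<one> \<in> W C g m" for m
        by (auto simp: W_def filtration_def)
      show "inv a \<in> W C g m" if "a \<in> W C g m" for a m
        using that by (simp add: W_def filtration_def)
      show "a \<otimes> b \<in> W C g m" if "a \<in> W C g (Suc m)" "b \<in> W C g (Suc m)" for a b m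
        using that by (simp add: W_def filtration_def)
    qed blast
  qed
  then obtain N where N: "\<And>C g. C \<in> \<C> \<Longrightarrow> openin T (N C g) \<and> \<one> \<in> N C g \<and> N C g \<subseteq> W C g 0"
    by metis
  define \<L> where "\<L> = (\<lambda>(C, g). N C g) ` (\<C> \<times> \<D>)"
  have "\<exists>V\<in>\<L>. V \<subseteq> U" if U: "openin T U" "\<one> \<in> U" for U
  proof -
    obtain F where F: "filtration F" "\<And>m. openin T (F m)" "F 0 \<subseteq> U"
      using open_filtration[OF U] by blast
    have "\<exists>s\<in>?F. fine_cover n (cov n s) (F m)" for n m
      using finite_fine_cover[OF B F(1,2), of n m] unfolding cov[symmetric] by blast
    then obtain s where s: "\<And>n m. s n m \<in> ?F" "\<And>n m. fine_cover n (cov n (s n m)) (F m)"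
      by metis
    \<comment> \<open>The codes \<open>s n m\<close> may be finitely many; adding \<open>E\<close>
      gives an infinite set.\<close>
    obtain E where E: "E \<subseteq> ?F" "countable E" "infinite E"
      using infinite_countable_subset'[OF infinite_compact_weight] by blast
    have "range (\<lambda>(n, m). s n m) \<union> E \<in> countably_infinite_subsets ?F"
      using s(1) E by (auto simp: countably_infinite_subsets_def)
    then obtain C where C': "C \<in> \<C>" "range (\<lambda>(n, m). s n m) \<union> E \<subseteq> C"
      using assms(3) by blast
    have "countable C"
      using C'(1) assms(2) by (auto simp: countably_infinite_subsets_def)
    have "\<exists>k. from_nat_into C k = s n m" for n m
      using C'(2) by (intro from_nat_into_surj[OF \<open>countable C\<close>]) auto
    then obtain k where k: "\<And>n m. from_nat_into C (k n m) = s n m"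
      by metis
    \<comment> \<open>The function \<open>g\<close> bounds the positions at which the enumeration of
      \<open>C\<close> lists the codes of \<open>F\<close>, so \<open>(C, g)\<close> captures
      \<open>F\<close>.\<close>
    obtain g where g: "g \<in> \<D>" "(\<lambda>j. case prod_decode j of (n, m) \<Rightarrow> k n m) \<le> g"
      using D by blast
    have "k n m \<le> g (prod_encode (n, m))" for n m
      using le_funD[OF g(2), of "prod_encode (n, m)"] by simp
    then have "fits C g F"
      unfolding fits_def using s(2) k by metis
    then have "N C g \<subseteq> U"
      using N[OF C'(1), of g] F(1,3) unfolding W_def by blast
    then show ?thesis
      using C'(1) g(1) by (auto simp: \<L>_def)
  qed
  moreover have "openin T V \<and> \<one> \<in> V" if "V \<in> \<L>" for V
    using that N unfolding \<L>_def by auto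
  ultimately have "local_base T \<one> \<L>"
    unfolding local_base_def by blast
  moreover have "|\<L>| \<le>o |\<C> \<times> \<D>|"
    unfolding \<L>_def by (rule card_of_image)
  ultimately show ?thesis by blast
qed

end

section \<open>Combining the lower and upper bounds\<close>

theorem theorem1p5:
  fixes X :: "'a topology" and A :: "'g monoid" and T :: "'g topology" and i :: "'a \<Rightarrow> 'g"
  assumes "tychonoff_space X" and "k_omega_space X"
    and "X \<noteq> discrete_topology (topspace X)"
    and "free_abelian_topological_group X A T i"
  shows "group_character A T =o
    cmax dominating_number (cof (countably_infinite_subsets (Field (compact_weight X))))"
proof -
  from assms(2) obtain K :: "nat \<Rightarrow> 'a set" where K: "\<forall>n. compactin X (K n)"
    "\<forall>C. compactin X C \<longrightarrow> (\<exists>n. C \<subseteq> K n)"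
    "\<forall>U. U \<subseteq> topspace X \<and> (\<forall>n. openin (subtopology X (K n)) (U \<inter> K n)) \<longrightarrow> openin X U"
    unfolding k_omega_space_def by (elim exE conjE)
  interpret free_abelian_k_omega X A T i K
  proof unfold_locales
    show "openin X U" if "U \<subseteq> topspace X" "\<And>n. openin (subtopology X (K n)) (U \<inter> K n)" for U
      using K(3) that by blast
  qed (use assms K(1,2) in auto)
  let ?S = "countably_infinite_subsets (Field (compact_weight X))"
  let ?d = "dominating_number" and ?c = "cof ?S"
  have co: "Card_order ?d" "Card_order ?c"
    unfolding dominating_number_def cof_def by (rule min_card_Card_order)+
  have "local_base T \<one>\<^bsub>A\<^esub> {V. openin T V \<and> \<one>\<^bsub>A\<^esub> \<in> V}"
    unfolding local_base_def by blast
  then obtain \<B> where \<B>: "local_base T \<one>\<^bsub>A\<^esub> \<B>" "group_character A T = |\<B>|"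
    unfolding group_character_def by (rule min_card)
  have "cmax ?d ?c \<le>o group_character A T"
    unfolding \<B>(2) using co dominating_number_le[OF \<B>(1)] cof_countable_le[OF \<B>(1)]
    by (rule cmax_least)
  moreover have "group_character A T \<le>o cmax ?d ?c"
  proof -
    obtain \<D> where D: "\<forall>p\<in>UNIV. \<exists>q\<in>\<D>. p \<le> q" "?d = |\<D>|"
      using cof_attained[of "UNIV :: (nat \<Rightarrow> nat) set"] unfolding dominating_number_def by blast
    obtain \<C> where C: "\<C> \<subseteq> ?S" "\<forall>S\<in>?S. \<exists>C\<in>\<C>. S \<subseteq> C" "?c = |\<C>|"
      using cof_attained[of ?S] by blast
    obtain \<L> where L: "local_base T \<one>\<^bsub>A\<^esub> \<L>" "|\<L>| \<le>o |\<C> \<times> \<D>|"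
      using small_local_base[of \<D> \<C>] D(1) C(1,2) by auto
    \<comment> \<open>Infinity of the dominating number makes the maximum infinite, so it also
      bounds the product of the two cofinal families.\<close>
    have "infinite (Field ?d)"
      unfolding D(2) Field_card_of using D(1) by (intro infinite_dominating) simp
    then have "infinite (Field (cmax ?d ?c))"
      using finite_cmax[OF co] by simp
    then have CD: "|\<C> \<times> \<D>| \<le>o cmax ?d ?c"
      using ordLeq_cmax[OF co] Card_order_cmax[OF co] unfolding C(3) D(2)
      by (intro card_of_Times_ordLeq_infinite_Field) auto
    have "group_character A T \<le>o |\<L>|"
      unfolding group_character_def using L(1) by (rule min_card_le)
    then show ?thesis
      by (rule ordLeq_transitive[OF ordLeq_transitive[OF _ L(2)] CD])
  qed
  ultimately show ?thesis
    by (simp add: ordIso_iff_ordLeq)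
qed

end
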